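(* Let $\mathcal{A}$ be a locally noetherian Grothendieck category, let $\gamma$ be a left exact radical functor on $\mathcal{A}$ with corresponding torsion theory $(\mathcal{T}_\gamma,\mathcal{F}_\gamma)$, and let $F:\mathcal{A}\to\mathcal{A}/\mathcal{T}_\gamma$ be the canonical functor with right adjoint $G:\mathcal{A}/\mathcal{T}_\gamma\to\mathcal{A}$. If $M$ is a $\gamma$-torsion-free object of $\mathcal{A}$, then, up to isomorphism, $GF(M)$ is the smallest faithfully $\gamma$-injective object containing $M$. That is, $GF(M)$ is faithfully $\gamma$-injective and contains $M$ (via the unit $h:M\to GF(M)$), and for every faithfully $\gamma$-injective object $D_1$ with a monomorphism $f:M\to D_1$ there is a monomorphism $\theta:GF(M)\to D_1$ with $\theta\circ h=f$.
   Context: A preradical functor on $\mathcal{A}$ is a subobject $\gamma$ of the identity functor: $\gamma(M)$ is a subobject of $M$ for each object $M$, and for $f:M\to N$ the morphism $\gamma(f)$ is the restriction of $f$ to $\gamma(M)$. It is radical if $\gamma(M/\gamma(M))=0$ for every $M$. Put $\mathcal{T}_\gamma=\{T\in\mathcal{A}\mid\gamma(T)=T\}$ (the $\gamma$-torsion objects) and $\mathcal{F}_\gamma=\{F\in\mathcal{A}\mid\gamma(F)=0\}$ (the $\gamma$-torsion-free objects). For a left exact radical functor $\gamma$, $\mathcal{T}_\gamma$ is a localizing subcategory, i.e. a Serre subcategory such that the canonical functor $\mathcal{A}\to\mathcal{A}/\mathcal{T}_\gamma$ to the quotient category has a right adjoint. An object $D$ is $\gamma$-injective if $\mathrm{Ext}^1_{\mathcal{A}}(X,D)=0$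 for every $\gamma$-torsion object $X$; it is faithfully $\gamma$-injective if it is $\gamma$-injective and $\gamma$-torsion-free. *)

theory Defs
  imports "HOL-Algebra.Group" "HOL-Library.Equipollence"
begin

section \<open>Categories and functors\<close>

text \<open>The composite \<open>g \<cdot>\<^bsub>C\<^esub> f\<close> is ``\<open>g\<close> after \<open>f\<close>''.
  All fields are meaningful only on \<open>Obj\<close>, \<open>Arr\<close> and composable pairs.\<close>

record ('o, 'm) cat =
  Obj :: "'o set"
  Arr :: "'m set"
  Dom :: "'m \<Rightarrow> 'o"
  Cod :: "'m \<Rightarrow> 'o"
  Ident :: "'o \<Rightarrow> 'm"
  Comp :: "'m \<Rightarrow> 'm \<Rightarrow> 'm" (infixr "\<cdot>\<index>" 70)

definition Hom :: "('o, 'm) cat \<Rightarrow> 'o \<Rightarrow> 'o \<Rightarrow> 'm set" where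
  "Hom C X Y = {f \<in> Arr C. Dom C f = X \<and> Cod C f = Y}"

definition category :: "('o, 'm) cat \<Rightarrow> bool" where
  "category C \<longleftrightarrow>
     (\<forall>f\<in>Arr C. Dom C f \<in> Obj C \<and> Cod C f \<in> Obj C) \<and>
     (\<forall>X\<in>Obj C. Ident C X \<in> Hom C X X) \<and>
     (\<forall>f\<in>Arr C. \<forall>g\<in>Arr C. Cod C f = Dom C g \<longrightarrow> g \<cdot>\<^bsub>C\<^esub> f \<in> Hom C (Dom C f) (Cod C g)) \<and>
     (\<forall>f\<in>Arr C. f \<cdot>\<^bsub>C\<^esub> Ident C (Dom C f) = f \<and> Ident C (Cod C f) \<cdot>\<^bsub>C\<^esub> f = f) \<and>
     (\<forall>f\<in>Arr C. \<forall>g\<in>Arr C. \<forall>h\<in>Arr C. Cod C f = Dom C g \<longrightarrow> Cod C g = Dom C h \<longrightarrow>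
        (h \<cdot>\<^bsub>C\<^esub> g) \<cdot>\<^bsub>C\<^esub> f = h \<cdot>\<^bsub>C\<^esub> (g \<cdot>\<^bsub>C\<^esub> f))"

definition mono_arr :: "('o, 'm) cat \<Rightarrow> 'm \<Rightarrow> bool" where
  "mono_arr C f \<longleftrightarrow> f \<in> Arr C \<and>
     (\<forall>a\<in>Arr C. \<forall>b\<in>Arr C. Dom C a = Dom C b \<longrightarrow> Cod C a = Dom C f \<longrightarrow> Cod C b = Dom C f \<longrightarrow>
        f \<cdot>\<^bsub>C\<^esub> a = f \<cdot>\<^bsub>C\<^esub> b \<longrightarrow> a = b)"

definition epi_arr :: "('o, 'm) cat \<Rightarrow> 'm \<Rightarrow> bool" where
  "epi_arr C f \<longleftrightarrow> f \<in> Arr C \<and>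
     (\<forall>a\<in>Arr C. \<forall>b\<in>Arr C. Cod C a = Cod C b \<longrightarrow> Dom C a = Cod C f \<longrightarrow> Dom C b = Cod C f \<longrightarrow>
        a \<cdot>\<^bsub>C\<^esub> f = b \<cdot>\<^bsub>C\<^esub> f \<longrightarrow> a = b)"

definition iso_arr :: "('o, 'm) cat \<Rightarrow> 'm \<Rightarrow> bool" where
  "iso_arr C f \<longleftrightarrow> f \<in> Arr C \<and>
     (\<exists>g\<in>Hom C (Cod C f) (Dom C f).
        g \<cdot>\<^bsub>C\<^esub> f = Ident C (Dom C f) \<and> f \<cdot>\<^bsub>C\<^esub> g = Ident C (Cod C f))"

record ('o, 'm, 'p, 'n) functr =
  FObj :: "'o \<Rightarrow> 'p"
  FArr :: "'m \<Rightarrow> 'n"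

definition is_functor :: "('o, 'm) cat \<Rightarrow> ('p, 'n) cat \<Rightarrow> ('o, 'm, 'p, 'n) functr \<Rightarrow> bool" where
  "is_functor C D F \<longleftrightarrow>
     (\<forall>X\<in>Obj C. FObj F X \<in> Obj D \<and> FArr F (Ident C X) = Ident D (FObj F X)) \<and>
     (\<forall>f\<in>Arr C. FArr F f \<in> Hom D (FObj F (Dom C f)) (FObj F (Cod C f))) \<and>
     (\<forall>f\<in>Arr C. \<forall>g\<in>Arr C. Cod C f = Dom C g \<longrightarrow>
        FArr F (g \<cdot>\<^bsub>C\<^esub> f) = FArr F g \<cdot>\<^bsub>D\<^esub> FArr F f)"

definition id_functor :: "('o, 'm, 'o, 'm) functr" where
  "id_functor = \<lparr>FObj = (\<lambda>X. X), FArr = (\<lambda>f. f)\<rparr>"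

definition comp_functor ::
  "('p, 'n, 'q, 'k) functr \<Rightarrow> ('o, 'm, 'p, 'n) functr \<Rightarrow> ('o, 'm, 'q, 'k) functr" where
  "comp_functor G F = \<lparr>FObj = FObj G \<circ> FObj F, FArr = FArr G \<circ> FArr F\<rparr>"

definition nat_trans :: "('o, 'm) cat \<Rightarrow> ('p, 'n) cat \<Rightarrow>
    ('o, 'm, 'p, 'n) functr \<Rightarrow> ('o, 'm, 'p, 'n) functr \<Rightarrow> ('o \<Rightarrow> 'n) \<Rightarrow> bool" where
  "nat_trans C D F G \<tau> \<longleftrightarrow>
     (\<forall>X\<in>Obj C. \<tau> X \<in> Hom D (FObj F X) (FObj G X)) \<and>
     (\<forall>f\<in>Arr C. \<tau> (Cod C f) \<cdot>\<^bsub>D\<^esub> FArr F f = FArr G f \<cdot>\<^bsub>D\<^esub> \<tau> (Dom C f))"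

definition adjunction :: "('o, 'm) cat \<Rightarrow> ('p, 'n) cat \<Rightarrow>
    ('o, 'm, 'p, 'n) functr \<Rightarrow> ('p, 'n, 'o, 'm) functr \<Rightarrow> ('o \<Rightarrow> 'm) \<Rightarrow> ('p \<Rightarrow> 'n) \<Rightarrow> bool" where
  "adjunction C D F G \<eta> \<epsilon> \<longleftrightarrow>
     is_functor C D F \<and> is_functor D C G \<and>
     nat_trans C C id_functor (comp_functor G F) \<eta> \<and>
     nat_trans D D (comp_functor F G) id_functor \<epsilon> \<and>
     (\<forall>X\<in>Obj C. \<epsilon> (FObj F X) \<cdot>\<^bsub>D\<^esub> FArr F (\<eta> X) = Ident D (FObj F X)) \<and>
     (\<forall>Y\<in>Obj D. FArr G (\<epsilon> Y) \<cdot>\<^bsub>C\<^esub> \<eta> (FObj G Y) = Ident C (FObj G Y))"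


section \<open>Abelian categories\<close>

definition zero_obj :: "('o, 'm) cat \<Rightarrow> 'o \<Rightarrow> bool" where
  "zero_obj C Z \<longleftrightarrow> Z \<in> Obj C \<and>
     (\<forall>X\<in>Obj C. (\<exists>!f. f \<in> Hom C X Z) \<and> (\<exists>!f. f \<in> Hom C Z X))"

definition zero_arr :: "('o, 'm) cat \<Rightarrow> 'm \<Rightarrow> bool" where
  "zero_arr C f \<longleftrightarrow>
     (\<exists>Z a b. zero_obj C Z \<and> a \<in> Hom C (Dom C f) Z \<and> b \<in> Hom C Z (Cod C f) \<and> f = b \<cdot>\<^bsub>C\<^esub> a)"

definition is_kernel :: "('o, 'm) cat \<Rightarrow> 'm \<Rightarrow> 'm \<Rightarrow> bool" where
  "is_kernel C k f \<longleftrightarrow> k \<in> Arr C \<and> f \<in> Arr C \<and> Cod C k = Dom C f \<and> zero_arr C (f \<cdot>\<^bsub>C\<^esub> k) \<and>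
     (\<forall>g\<in>Arr C. Cod C g = Dom C f \<longrightarrow> zero_arr C (f \<cdot>\<^bsub>C\<^esub> g) \<longrightarrow>
        (\<exists>!u. u \<in> Hom C (Dom C g) (Dom C k) \<and> k \<cdot>\<^bsub>C\<^esub> u = g))"

definition is_cokernel :: "('o, 'm) cat \<Rightarrow> 'm \<Rightarrow> 'm \<Rightarrow> bool" where
  "is_cokernel C c f \<longleftrightarrow> c \<in> Arr C \<and> f \<in> Arr C \<and> Dom C c = Cod C f \<and> zero_arr C (c \<cdot>\<^bsub>C\<^esub> f) \<and>
     (\<forall>g\<in>Arr C. Dom C g = Cod C f \<longrightarrow> zero_arr C (g \<cdot>\<^bsub>C\<^esub> f) \<longrightarrow>
        (\<exists>!u. u \<in> Hom C (Cod C c) (Cod C g) \<and> u \<cdot>\<^bsub>C\<^esub> c = g))"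

definition short_exact :: "('o, 'm) cat \<Rightarrow> 'm \<Rightarrow> 'm \<Rightarrow> bool" where
  "short_exact C i p \<longleftrightarrow> is_kernel C i p \<and> is_cokernel C p i"

definition preadditive :: "('o, 'm) cat \<Rightarrow> ('m \<Rightarrow> 'm \<Rightarrow> 'm) \<Rightarrow> ('o \<Rightarrow> 'o \<Rightarrow> 'm) \<Rightarrow> bool" where
  "preadditive C add z \<longleftrightarrow>
     (\<forall>X\<in>Obj C. \<forall>Y\<in>Obj C.
        comm_group \<lparr>carrier = Hom C X Y, monoid.mult = add, one = z X Y\<rparr>) \<and>
     (\<forall>X\<in>Obj C. \<forall>Y\<in>Obj C. \<forall>W\<in>Obj C. \<forall>f\<in>Hom C X Y. \<forall>f'\<in>Hom C X Y. \<forall>g\<in>Hom C Y W. \<forall>g'\<in>Hom C Y W.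
        g \<cdot>\<^bsub>C\<^esub> add f f' = add (g \<cdot>\<^bsub>C\<^esub> f) (g \<cdot>\<^bsub>C\<^esub> f') \<and>
        add g g' \<cdot>\<^bsub>C\<^esub> f = add (g \<cdot>\<^bsub>C\<^esub> f) (g' \<cdot>\<^bsub>C\<^esub> f))"

definition is_product :: "('o, 'm) cat \<Rightarrow> 'o \<Rightarrow> 'o \<Rightarrow> 'm \<Rightarrow> 'm \<Rightarrow> bool" where
  "is_product C X Y p q \<longleftrightarrow> p \<in> Arr C \<and> q \<in> Arr C \<and> Dom C p = Dom C q \<and> Cod C p = X \<and> Cod C q = Y \<and>
     (\<forall>a\<in>Arr C. \<forall>b\<in>Arr C. Dom C a = Dom C b \<longrightarrow> Cod C a = X \<longrightarrow> Cod C b = Y \<longrightarrow>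
        (\<exists>!u. u \<in> Hom C (Dom C a) (Dom C p) \<and> p \<cdot>\<^bsub>C\<^esub> u = a \<and> q \<cdot>\<^bsub>C\<^esub> u = b))"

text \<open>The addition of arrows is not part of the record \<open>cat\<close>: in the presence of a zero object and
  binary products it is determined by the category.\<close>

definition abelian :: "('o, 'm) cat \<Rightarrow> bool" where
  "abelian C \<longleftrightarrow> category C \<and>
     (\<exists>add z. preadditive C add z) \<and>
     (\<exists>Z. zero_obj C Z) \<and>
     (\<forall>X\<in>Obj C. \<forall>Y\<in>Obj C. \<exists>p q. is_product C X Y p q) \<and>
     (\<forall>f\<in>Arr C. \<exists>k. is_kernel C k f) \<and>
     (\<forall>f\<in>Arr C. \<exists>c. is_cokernel C c f) \<and>
     (\<forall>f. mono_arr C f \<longrightarrow> (\<exists>g. is_kernel C f g)) \<and>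
     (\<forall>f. epi_arr C f \<longrightarrow> (\<exists>g. is_cokernel C f g))"


section \<open>Locally noetherian Grothendieck categories\<close>

text \<open>A category whose arrows form a set in HOL cannot have coproducts indexed by sets of every HOL
  type (unless all its objects are zero), so ``small'' is relative to a type \<open>'u\<close>: a set is small
  if it has strictly smaller cardinality than \<open>'u\<close>.  The cardinality \<open>\<kappa>\<close> of \<open>'u\<close> has to be uncountable
  and regular.  The Grothendieck universes are the case where \<open>\<kappa>\<close> is moreover a strong limit; as HOL
  does not prove that such a \<open>\<kappa>\<close> exists, this is not demanded.  For the same reason hom-sets are not
  required to be \<open>'u\<close>-small: coproducts and small hom-sets together force \<open>\<kappa>\<close> to be a strong limit.\<close>

definition small :: "'u set \<Rightarrow> bool" where
  "small I \<longleftrightarrow> I \<prec> (UNIV :: 'u set)"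

definition small_universe :: "'u itself \<Rightarrow> bool" where
  "small_universe (_ :: 'u itself) \<longleftrightarrow>
     uncountable (UNIV :: 'u set) \<and>
     (\<forall>(I :: 'u set) (S :: 'u \<Rightarrow> 'u set). small I \<longrightarrow> (\<forall>i\<in>I. small (S i)) \<longrightarrow> small (\<Union>i\<in>I. S i))"

definition is_coproduct :: "('o, 'm) cat \<Rightarrow> 'u set \<Rightarrow> ('u \<Rightarrow> 'o) \<Rightarrow> 'o \<Rightarrow> ('u \<Rightarrow> 'm) \<Rightarrow> bool" where
  "is_coproduct C I X P c \<longleftrightarrow> P \<in> Obj C \<and> (\<forall>i\<in>I. c i \<in> Hom C (X i) P) \<and>
     (\<forall>Y\<in>Obj C. \<forall>g. (\<forall>i\<in>I. g i \<in> Hom C (X i) Y) \<longrightarrow>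
        (\<exists>!u. u \<in> Hom C P Y \<and> (\<forall>i\<in>I. u \<cdot>\<^bsub>C\<^esub> c i = g i)))"

text \<open>\<open>leq\<close> is a directed preorder on the nonempty set \<open>I\<close>; \<open>t i j\<close> is the transition arrow
  \<open>X i \<rightarrow> X j\<close>.\<close>

definition directed_index :: "'u set \<Rightarrow> ('u \<Rightarrow> 'u \<Rightarrow> bool) \<Rightarrow> bool" where
  "directed_index I leq \<longleftrightarrow> I \<noteq> {} \<and> (\<forall>i\<in>I. leq i i) \<and>
     (\<forall>i\<in>I. \<forall>j\<in>I. \<forall>k\<in>I. leq i j \<longrightarrow> leq j k \<longrightarrow> leq i k) \<and>
     (\<forall>i\<in>I. \<forall>j\<in>I. \<exists>k\<in>I. leq i k \<and> leq j k)"

definition directed_system ::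
  "('o, 'm) cat \<Rightarrow> 'u set \<Rightarrow> ('u \<Rightarrow> 'u \<Rightarrow> bool) \<Rightarrow> ('u \<Rightarrow> 'o) \<Rightarrow> ('u \<Rightarrow> 'u \<Rightarrow> 'm) \<Rightarrow> bool" where
  "directed_system C I leq X t \<longleftrightarrow>
     (\<forall>i\<in>I. X i \<in> Obj C \<and> t i i = Ident C (X i)) \<and>
     (\<forall>i\<in>I. \<forall>j\<in>I. leq i j \<longrightarrow> t i j \<in> Hom C (X i) (X j)) \<and>
     (\<forall>i\<in>I. \<forall>j\<in>I. \<forall>k\<in>I. leq i j \<longrightarrow> leq j k \<longrightarrow> t i k = t j k \<cdot>\<^bsub>C\<^esub> t i j)"

definition is_cocone :: "('o, 'm) cat \<Rightarrow> 'u set \<Rightarrow> ('u \<Rightarrow> 'u \<Rightarrow> bool) \<Rightarrow> ('u \<Rightarrow> 'o) \<Rightarrow>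
    ('u \<Rightarrow> 'u \<Rightarrow> 'm) \<Rightarrow> 'o \<Rightarrow> ('u \<Rightarrow> 'm) \<Rightarrow> bool" where
  "is_cocone C I leq X t L c \<longleftrightarrow> L \<in> Obj C \<and> (\<forall>i\<in>I. c i \<in> Hom C (X i) L) \<and>
     (\<forall>i\<in>I. \<forall>j\<in>I. leq i j \<longrightarrow> c j \<cdot>\<^bsub>C\<^esub> t i j = c i)"

definition is_colimit :: "('o, 'm) cat \<Rightarrow> 'u set \<Rightarrow> ('u \<Rightarrow> 'u \<Rightarrow> bool) \<Rightarrow> ('u \<Rightarrow> 'o) \<Rightarrow>
    ('u \<Rightarrow> 'u \<Rightarrow> 'm) \<Rightarrow> 'o \<Rightarrow> ('u \<Rightarrow> 'm) \<Rightarrow> bool" where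
  "is_colimit C I leq X t L c \<longleftrightarrow> is_cocone C I leq X t L c \<and>
     (\<forall>Y g. is_cocone C I leq X t Y g \<longrightarrow>
        (\<exists>!u. u \<in> Hom C L Y \<and> (\<forall>i\<in>I. u \<cdot>\<^bsub>C\<^esub> c i = g i)))"

definition system_map :: "('o, 'm) cat \<Rightarrow> 'u set \<Rightarrow> ('u \<Rightarrow> 'u \<Rightarrow> bool) \<Rightarrow>
    ('u \<Rightarrow> 'o) \<Rightarrow> ('u \<Rightarrow> 'u \<Rightarrow> 'm) \<Rightarrow> ('u \<Rightarrow> 'o) \<Rightarrow> ('u \<Rightarrow> 'u \<Rightarrow> 'm) \<Rightarrow> ('u \<Rightarrow> 'm) \<Rightarrow> bool" where
  "system_map C I leq X t Y s a \<longleftrightarrow> (\<forall>i\<in>I. a i \<in> Hom C (X i) (Y i)) \<and>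
     (\<forall>i\<in>I. \<forall>j\<in>I. leq i j \<longrightarrow> a j \<cdot>\<^bsub>C\<^esub> t i j = s i j \<cdot>\<^bsub>C\<^esub> a i)"

definition has_small_coproducts :: "'u itself \<Rightarrow> ('o, 'm) cat \<Rightarrow> bool" where
  "has_small_coproducts (_ :: 'u itself) C \<longleftrightarrow>
     (\<forall>(I :: 'u set) X. small I \<longrightarrow> (\<forall>i\<in>I. X i \<in> Obj C) \<longrightarrow> (\<exists>P c. is_coproduct C I X P c))"

definition exact_direct_limits :: "'u itself \<Rightarrow> ('o, 'm) cat \<Rightarrow> bool" where
  "exact_direct_limits (_ :: 'u itself) C \<longleftrightarrow>
     (\<forall>(I :: 'u set) leq X t Y s Z r a b L c M d N e \<alpha> \<beta>.
        small I \<longrightarrow> directed_index I leq \<longrightarrow>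
        directed_system C I leq X t \<longrightarrow> directed_system C I leq Y s \<longrightarrow> directed_system C I leq Z r \<longrightarrow>
        system_map C I leq X t Y s a \<longrightarrow> system_map C I leq Y s Z r b \<longrightarrow>
        (\<forall>i\<in>I. short_exact C (a i) (b i)) \<longrightarrow>
        is_colimit C I leq X t L c \<longrightarrow> is_colimit C I leq Y s M d \<longrightarrow> is_colimit C I leq Z r N e \<longrightarrow>
        \<alpha> \<in> Hom C L M \<longrightarrow> (\<forall>i\<in>I. \<alpha> \<cdot>\<^bsub>C\<^esub> c i = d i \<cdot>\<^bsub>C\<^esub> a i) \<longrightarrow>
        \<beta> \<in> Hom C M N \<longrightarrow> (\<forall>i\<in>I. \<beta> \<cdot>\<^bsub>C\<^esub> d i = e i \<cdot>\<^bsub>C\<^esub> b i) \<longrightarrow>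
        short_exact C \<alpha> \<beta>)"

definition generating_family :: "('o, 'm) cat \<Rightarrow> 'u set \<Rightarrow> ('u \<Rightarrow> 'o) \<Rightarrow> bool" where
  "generating_family C I U \<longleftrightarrow> (\<forall>i\<in>I. U i \<in> Obj C) \<and>
     (\<forall>f\<in>Arr C. \<forall>g\<in>Arr C. Dom C f = Dom C g \<longrightarrow> Cod C f = Cod C g \<longrightarrow> f \<noteq> g \<longrightarrow>
        (\<exists>i\<in>I. \<exists>h\<in>Hom C (U i) (Dom C f). f \<cdot>\<^bsub>C\<^esub> h \<noteq> g \<cdot>\<^bsub>C\<^esub> h))"

definition generator :: "('o, 'm) cat \<Rightarrow> 'o \<Rightarrow> bool" where
  "generator C U \<longleftrightarrow> generating_family C {()} (\<lambda>_. U)"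

definition grothendieck :: "'u itself \<Rightarrow> ('o, 'm) cat \<Rightarrow> bool" where
  "grothendieck (u :: 'u itself) C \<longleftrightarrow>
     abelian C \<and> has_small_coproducts u C \<and> exact_direct_limits u C \<and> (\<exists>U. generator C U)"

text \<open>Subobjects are represented by monomorphisms; \<open>sub_le\<close> is their inclusion preorder.\<close>

definition sub_le :: "('o, 'm) cat \<Rightarrow> 'm \<Rightarrow> 'm \<Rightarrow> bool" where
  "sub_le C m n \<longleftrightarrow> (\<exists>u\<in>Hom C (Dom C m) (Dom C n). m = n \<cdot>\<^bsub>C\<^esub> u)"

definition noetherian_obj :: "('o, 'm) cat \<Rightarrow> 'o \<Rightarrow> bool" where
  "noetherian_obj C X \<longleftrightarrow> X \<in> Obj C \<and>
     (\<forall>m :: nat \<Rightarrow> 'm. (\<forall>n. mono_arr C (m n) \<and> Cod C (m n) = X) \<longrightarrow> (\<forall>n. sub_le C (m n) (m (Suc n))) \<longrightarrow>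
        (\<exists>N. \<forall>n\<ge>N. sub_le C (m n) (m N)))"

definition locally_noetherian_grothendieck :: "'u itself \<Rightarrow> ('o, 'm) cat \<Rightarrow> bool" where
  "locally_noetherian_grothendieck (u :: 'u itself) C \<longleftrightarrow> grothendieck u C \<and>
     (\<exists>(I :: 'u set) U. small I \<and> generating_family C I U \<and> (\<forall>i\<in>I. noetherian_obj C (U i)))"


section \<open>Left exact radical functors and their torsion theories\<close>

text \<open>The subobject \<open>\<gamma>(M)\<close> of \<open>M\<close> is the monomorphism \<open>\<iota> M\<close>; naturality of \<open>\<iota>\<close> says that \<open>\<gamma>(f)\<close> is
  the restriction of \<open>f\<close>.\<close>

definition preradical :: "('o, 'm) cat \<Rightarrow> ('o, 'm, 'o, 'm) functr \<Rightarrow> ('o \<Rightarrow> 'm) \<Rightarrow> bool" where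
  "preradical C \<gamma> \<iota> \<longleftrightarrow> is_functor C C \<gamma> \<and> nat_trans C C \<gamma> id_functor \<iota> \<and>
     (\<forall>M\<in>Obj C. mono_arr C (\<iota> M))"

definition radical :: "('o, 'm) cat \<Rightarrow> ('o, 'm, 'o, 'm) functr \<Rightarrow> ('o \<Rightarrow> 'm) \<Rightarrow> bool" where
  "radical C \<gamma> \<iota> \<longleftrightarrow> preradical C \<gamma> \<iota> \<and>
     (\<forall>M\<in>Obj C. \<forall>q. is_cokernel C q (\<iota> M) \<longrightarrow> zero_obj C (FObj \<gamma> (Cod C q)))"

text \<open>An exact sequence \<open>0 \<rightarrow> X \<rightarrow> Y \<rightarrow> Z\<close> is the same as a kernel \<open>X \<rightarrow> Y\<close> of \<open>Y \<rightarrow> Z\<close>.  Subfunctors of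
  the identity are automatically additive.\<close>

definition left_exact :: "('o, 'm) cat \<Rightarrow> ('p, 'n) cat \<Rightarrow> ('o, 'm, 'p, 'n) functr \<Rightarrow> bool" where
  "left_exact C D F \<longleftrightarrow> (\<forall>k f. is_kernel C k f \<longrightarrow> is_kernel D (FArr F k) (FArr F f))"

definition left_exact_radical :: "('o, 'm) cat \<Rightarrow> ('o, 'm, 'o, 'm) functr \<Rightarrow> ('o \<Rightarrow> 'm) \<Rightarrow> bool" where
  "left_exact_radical C \<gamma> \<iota> \<longleftrightarrow> radical C \<gamma> \<iota> \<and> left_exact C C \<gamma>"

definition torsion :: "('o, 'm) cat \<Rightarrow> ('o \<Rightarrow> 'm) \<Rightarrow> 'o set" where
  "torsion C \<iota> = {T \<in> Obj C. iso_arr C (\<iota> T)}"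

definition torsion_free :: "('o, 'm) cat \<Rightarrow> ('o, 'm, 'o, 'm) functr \<Rightarrow> 'o set" where
  "torsion_free C \<gamma> = {X \<in> Obj C. zero_obj C (FObj \<gamma> X)}"


section \<open>Relative injectivity\<close>

text \<open>\<open>Ext1 C X D\<close> is the set underlying the Yoneda Ext group \<open>Ext\<^sup>1(X, D)\<close>: extensions
  \<open>0 \<rightarrow> D \<rightarrow> E \<rightarrow> X \<rightarrow> 0\<close>, given as \<open>(i, p)\<close>, up to isomorphism over \<open>X\<close> and under \<open>D\<close>.  Its zero
  element is the class consisting of the split extensions.\<close>

definition extensions :: "('o, 'm) cat \<Rightarrow> 'o \<Rightarrow> 'o \<Rightarrow> ('m \<times> 'm) set" where
  "extensions C X D = {(i, p). short_exact C i p \<and> Dom C i = D \<and> Cod C p = X}"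

definition ext_equiv :: "('o, 'm) cat \<Rightarrow> 'o \<Rightarrow> 'o \<Rightarrow> (('m \<times> 'm) \<times> ('m \<times> 'm)) set" where
  "ext_equiv C X D = {((i, p), (i', p')).
     (i, p) \<in> extensions C X D \<and> (i', p') \<in> extensions C X D \<and>
     (\<exists>\<phi>\<in>Hom C (Cod C i) (Cod C i'). iso_arr C \<phi> \<and> \<phi> \<cdot>\<^bsub>C\<^esub> i = i' \<and> p' \<cdot>\<^bsub>C\<^esub> \<phi> = p)}"

definition Ext1 :: "('o, 'm) cat \<Rightarrow> 'o \<Rightarrow> 'o \<Rightarrow> ('m \<times> 'm) set set" where
  "Ext1 C X D = extensions C X D // ext_equiv C X D"

definition Ext1_zero :: "('o, 'm) cat \<Rightarrow> 'o \<Rightarrow> 'o \<Rightarrow> ('m \<times> 'm) set" where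
  "Ext1_zero C X D = {(i, p) \<in> extensions C X D. \<exists>r\<in>Hom C (Cod C i) D. r \<cdot>\<^bsub>C\<^esub> i = Ident C D}"

definition rel_injective :: "('o, 'm) cat \<Rightarrow> ('o \<Rightarrow> 'm) \<Rightarrow> 'o \<Rightarrow> bool" where
  "rel_injective C \<iota> D \<longleftrightarrow> D \<in> Obj C \<and> (\<forall>X\<in>torsion C \<iota>. Ext1 C X D = {Ext1_zero C X D})"

definition faithfully_injective ::
  "('o, 'm) cat \<Rightarrow> ('o, 'm, 'o, 'm) functr \<Rightarrow> ('o \<Rightarrow> 'm) \<Rightarrow> 'o \<Rightarrow> bool" where
  "faithfully_injective C \<gamma> \<iota> D \<longleftrightarrow> rel_injective C \<iota> D \<and> D \<in> torsion_free C \<gamma>"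


section \<open>The quotient of an abelian category by a Serre subcategory\<close>

text \<open>For a Serre subcategory with object set \<open>T\<close>, the quotient \<open>C/T\<close> is the category of fractions of
  \<open>C\<close> at the arrows with kernel and cokernel in \<open>T\<close>.  These arrows admit a calculus of right
  fractions, so an arrow \<open>M \<rightarrow> N\<close> of \<open>C/T\<close> is a class of roofs \<open>M \<leftarrow>s\<midarrow> X \<midarrow>f\<rightarrow> N\<close>, written \<open>(s, f)\<close>,
  with \<open>s\<close> such an arrow.\<close>

definition quot_iso :: "('o, 'm) cat \<Rightarrow> 'o set \<Rightarrow> 'm \<Rightarrow> bool" where
  "quot_iso C T s \<longleftrightarrow> s \<in> Arr C \<and>
     (\<exists>k. is_kernel C k s \<and> Dom C k \<in> T) \<and> (\<exists>c. is_cokernel C c s \<and> Cod C c \<in> T)"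

definition roof :: "('o, 'm) cat \<Rightarrow> 'o set \<Rightarrow> 'm \<times> 'm \<Rightarrow> bool" where
  "roof C T = (\<lambda>(s, f). quot_iso C T s \<and> f \<in> Arr C \<and> Dom C s = Dom C f)"

definition roof_equiv :: "('o, 'm) cat \<Rightarrow> 'o set \<Rightarrow> 'm \<times> 'm \<Rightarrow> 'm \<times> 'm \<Rightarrow> bool" where
  "roof_equiv C T = (\<lambda>(s, f) (s', f').
     roof C T (s, f) \<and> roof C T (s', f') \<and> Cod C s = Cod C s' \<and> Cod C f = Cod C f' \<and>
     (\<exists>u\<in>Arr C. \<exists>u'\<in>Arr C. Dom C u = Dom C u' \<and> Cod C u = Dom C s \<and> Cod C u' = Dom C s' \<and>
        s \<cdot>\<^bsub>C\<^esub> u = s' \<cdot>\<^bsub>C\<^esub> u' \<and> quot_iso C T (s \<cdot>\<^bsub>C\<^esub> u) \<and> f \<cdot>\<^bsub>C\<^esub> u = f' \<cdot>\<^bsub>C\<^esub> u'))"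

definition roof_class :: "('o, 'm) cat \<Rightarrow> 'o set \<Rightarrow> 'm \<times> 'm \<Rightarrow> ('m \<times> 'm) set" where
  "roof_class C T x = {y. roof_equiv C T x y}"

text \<open>The composite of the classes of \<open>(s, f)\<close> and \<open>(t, g)\<close> is the class of \<open>(s w, g v)\<close> for any commutative
  square \<open>f w = t v\<close> in which \<open>w\<close> is inverted; \<open>Comp\<close> collects these over all choices, which all
  give the same class.\<close>

definition quot_cat :: "('o, 'm) cat \<Rightarrow> 'o set \<Rightarrow> ('o, ('m \<times> 'm) set) cat" where
  "quot_cat C T = \<lparr>
     Obj = Obj C,
     Arr = {roof_class C T x | x. roof C T x},
     Dom = (\<lambda>\<phi>. THE M. \<exists>(s, f)\<in>\<phi>. M = Cod C s),
     Cod = (\<lambda>\<phi>. THE N. \<exists>(s, f)\<in>\<phi>. N = Cod C f),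
     Ident = (\<lambda>M. roof_class C T (Ident C M, Ident C M)),
     Comp = (\<lambda>\<psi> \<phi>. \<Union> {roof_class C T (s \<cdot>\<^bsub>C\<^esub> w, g \<cdot>\<^bsub>C\<^esub> v) | s f t g w v.
        (s, f) \<in> \<phi> \<and> (t, g) \<in> \<psi> \<and> quot_iso C T w \<and> v \<in> Arr C \<and> Dom C w = Dom C v \<and>
        Cod C w = Dom C f \<and> Cod C v = Dom C t \<and> f \<cdot>\<^bsub>C\<^esub> w = t \<cdot>\<^bsub>C\<^esub> v})\<rparr>"

definition quot_functor :: "('o, 'm) cat \<Rightarrow> 'o set \<Rightarrow> ('o, 'm, 'o, ('m \<times> 'm) set) functr" where
  "quot_functor C T = \<lparr>
     FObj = (\<lambda>M. M),
     FArr = (\<lambda>f. roof_class C T (Ident C (Dom C f), f))\<rparr>"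

end

theory Submission
  imports Defs
begin

text \<open>Call an arrow dense if its cokernel is torsion; equivalently, it is epic as seen by torsion-free
  objects.  Left exactness of \<open>\<gamma>\<close> makes dense arrows stable under pullback, so that the arrows with
  torsion kernel and cokernel admit a calculus of right fractions.  As \<open>F\<close> inverts these arrows and
  kills torsion objects, adjointness makes every \<open>G Y\<close> torsion-free and injective with respect to
  them.  Writing the counit at \<open>F M\<close> as a fraction \<open>g s\<inverse>\<close>, adjointness gives \<open>h g = s\<close>, so the unit \<open>h\<close>
  of a torsion-free \<open>M\<close> is a dense monomorphism.  A monomorphism \<open>f : M \<rightarrow> D\<close> into a faithfully
  injective object extends along \<open>h\<close>, because the pushout extension of \<open>D\<close> by the torsion
  object \<open>coker h\<close> splits; the extension is again monic because \<open>h\<close> is dense and \<open>G F M\<close> is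
  torsion-free.\<close>

text \<open>Two obstacles shape the development. \<open>Comp\<close> of the quotient is a union over
  all representatives and all completing squares, so evaluating a composite means comparing every
  choice; the adjunction is therefore exploited through composites in which a denominator cancels.
  The other obstacle is that there are no elements to chase. Their role is taken by arrows
  considered up to precomposition with a dense arrow: an equation is proved after such a
  precomposition, and when the target is torsion-free the definition of \<open>dense\<close> allows
  passing back. For this reason torsion objects and torsion kernels are restated through dense
  arrows. Of the two conditions on \<gamma>, left exactness yields that torsion passes to subobjects
  and that \<gamma>(M) itself is torsion, while \<gamma>(M/\<gamma>(M)) = 0 yields that an object
  without nonzero arrows to torsion-free objects is torsion.\<close>

lemma (in group) ex_left_quotient:
  "\<lbrakk>x \<in> carrier G; y \<in> carrier G\<rbrakk> \<Longrightarrow> \<exists>d\<in>carrier G. d \<otimes> y = x"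
  by (rule bexI[of _ "x \<otimes> inv y"]) (simp_all add: m_assoc)

section \<open>Abelian categories\<close>

text \<open>\<open>abelian\<close> only asserts that some addition exists. Fixing one makes sums,
  differences and zero arrows available as terms; the final proof obtains it by unpacking
  \<open>abelian\<close>.\<close>

locale abelian_cat =
  fixes C :: "('o, 'm) cat" (structure)
    and add :: "'m \<Rightarrow> 'm \<Rightarrow> 'm" (infixl "\<oplus>" 65)
    and z :: "'o \<Rightarrow> 'o \<Rightarrow> 'm"
  assumes abelian: "abelian C"
    and preadditive: "preadditive C add z"
begin

section \<open>Category laws and addition of arrows\<close>

lemma category: "category C"
  using abelian by (simp add: abelian_def)

lemma dom_obj [simp]: "f \<in> Arr C \<Longrightarrow> Dom C f \<in> Obj C"
  and cod_obj [simp]: "f \<in> Arr C \<Longrightarrow> Cod C f \<in> Obj C"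
  and ident_arr [simp]: "X \<in> Obj C \<Longrightarrow> Ident C X \<in> Arr C"
  and dom_ident [simp]: "X \<in> Obj C \<Longrightarrow> Dom C (Ident C X) = X"
  and cod_ident [simp]: "X \<in> Obj C \<Longrightarrow> Cod C (Ident C X) = X"
  using category by (auto simp: category_def Hom_def)

lemma comp_arr [simp]: "\<lbrakk>f \<in> Arr C; g \<in> Arr C; Cod C f = Dom C g\<rbrakk> \<Longrightarrow> g \<cdot> f \<in> Arr C"
  and dom_comp [simp]: "\<lbrakk>f \<in> Arr C; g \<in> Arr C; Cod C f = Dom C g\<rbrakk> \<Longrightarrow> Dom C (g \<cdot> f) = Dom C f"
  and cod_comp [simp]: "\<lbrakk>f \<in> Arr C; g \<in> Arr C; Cod C f = Dom C g\<rbrakk> \<Longrightarrow> Cod C (g \<cdot> f) = Cod C g"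
  using category by (auto simp: category_def Hom_def)

lemma comp_ident [simp]: "\<lbrakk>f \<in> Arr C; Dom C f = X\<rbrakk> \<Longrightarrow> f \<cdot> Ident C X = f"
  and ident_comp [simp]: "\<lbrakk>f \<in> Arr C; Cod C f = X\<rbrakk> \<Longrightarrow> Ident C X \<cdot> f = f"
  using category by (auto simp: category_def)

lemma comp_assoc [simp]:
  "\<lbrakk>f \<in> Arr C; g \<in> Arr C; h \<in> Arr C; Cod C f = Dom C g; Cod C g = Dom C h\<rbrakk>
    \<Longrightarrow> (h \<cdot> g) \<cdot> f = h \<cdot> (g \<cdot> f)"
  using category by (auto simp: category_def)

lemma hom_arr [dest]: "f \<in> Hom C X Y \<Longrightarrow> f \<in> Arr C"
  and hom_dom: "f \<in> Hom C X Y \<Longrightarrow> Dom C f = X"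
  and hom_cod: "f \<in> Hom C X Y \<Longrightarrow> Cod C f = Y"
  by (auto simp: Hom_def)

lemma hom_obj: "f \<in> Hom C X Y \<Longrightarrow> X \<in> Obj C" "f \<in> Hom C X Y \<Longrightarrow> Y \<in> Obj C"
  by (auto simp: Hom_def)

lemma hom_comp [intro]: "\<lbrakk>g \<in> Hom C Y W; f \<in> Hom C X Y\<rbrakk> \<Longrightarrow> g \<cdot> f \<in> Hom C X W"
  by (simp add: Hom_def)

lemma ident_hom [intro, simp]: "X \<in> Obj C \<Longrightarrow> Ident C X \<in> Hom C X X"
  by (simp add: Hom_def)

lemma hom_assoc:
  "\<lbrakk>h \<in> Hom C Y W; g \<in> Hom C X Y; f \<in> Hom C V X\<rbrakk> \<Longrightarrow> (h \<cdot> g) \<cdot> f = h \<cdot> (g \<cdot> f)"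
  by (simp add: Hom_def)

lemma hom_ident: "f \<in> Hom C X Y \<Longrightarrow> f \<cdot> Ident C X = f" "f \<in> Hom C X Y \<Longrightarrow> Ident C Y \<cdot> f = f"
  by (simp_all add: Hom_def)

lemma comm_group_hom:
  "\<lbrakk>X \<in> Obj C; Y \<in> Obj C\<rbrakk> \<Longrightarrow> comm_group \<lparr>carrier = Hom C X Y, monoid.mult = add, one = z X Y\<rparr>"
  using preadditive by (simp add: preadditive_def)

lemma comp_add: "\<lbrakk>g \<in> Hom C Y W; f \<in> Hom C X Y; f' \<in> Hom C X Y\<rbrakk> \<Longrightarrow> g \<cdot> (f \<oplus> f') = g \<cdot> f \<oplus> g \<cdot> f'"
  and add_comp: "\<lbrakk>g \<in> Hom C Y W; g' \<in> Hom C Y W; f \<in> Hom C X Y\<rbrakk> \<Longrightarrow> (g \<oplus> g') \<cdot> f = g \<cdot> f \<oplus> g' \<cdot> f"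
  using preadditive hom_obj unfolding preadditive_def by blast+

lemma zero_hom [intro, simp]: "\<lbrakk>X \<in> Obj C; Y \<in> Obj C\<rbrakk> \<Longrightarrow> z X Y \<in> Hom C X Y"
  using comm_group_hom[of X Y]
  by (metis comm_group_def group.is_monoid monoid.one_closed partial_object.select_convs(1)
      monoid.select_convs(2))

lemma add_hom [intro]: "\<lbrakk>f \<in> Hom C X Y; g \<in> Hom C X Y\<rbrakk> \<Longrightarrow> f \<oplus> g \<in> Hom C X Y"
proof -
  assume f: "f \<in> Hom C X Y" and g: "g \<in> Hom C X Y"
  interpret H: comm_group "\<lparr>carrier = Hom C X Y, monoid.mult = add, one = z X Y\<rparr>"
    using comm_group_hom hom_obj f by blast
  show ?thesis using H.m_closed f g by simp
qed

lemma add_zero: "f \<in> Hom C X Y \<Longrightarrow> f \<oplus> z X Y = f"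
  and zero_add: "f \<in> Hom C X Y \<Longrightarrow> z X Y \<oplus> f = f"
  and add_eq_self_iff: "f \<in> Hom C X Y \<Longrightarrow> g \<in> Hom C X Y \<Longrightarrow> g \<oplus> f = f \<longleftrightarrow> g = z X Y"
  and ex_diff: "f \<in> Hom C X Y \<Longrightarrow> g \<in> Hom C X Y \<Longrightarrow> \<exists>d\<in>Hom C X Y. d \<oplus> g = f"
proof -
  assume f: "f \<in> Hom C X Y"
  interpret H: comm_group "\<lparr>carrier = Hom C X Y, monoid.mult = add, one = z X Y\<rparr>"
    by (rule comm_group_hom[OF hom_obj[OF f]])
  show "f \<oplus> z X Y = f" using H.r_one f by simp
  show "z X Y \<oplus> f = f" using H.l_one f by simp
  assume g: "g \<in> Hom C X Y"
  show "g \<oplus> f = f \<longleftrightarrow> g = z X Y" using H.r_cancel_one[of f g] f g by simp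
  show "\<exists>d\<in>Hom C X Y. d \<oplus> g = f" using H.ex_left_quotient[of f g] f g by simp
qed

lemma comp_zero: "\<lbrakk>f \<in> Hom C Y W; X \<in> Obj C\<rbrakk> \<Longrightarrow> f \<cdot> z X Y = z X W"
proof -
  assume f: "f \<in> Hom C Y W" and X: "X \<in> Obj C"
  have 0: "z X Y \<in> Hom C X Y" using hom_obj[OF f] X by simp
  have "f \<cdot> z X Y \<oplus> f \<cdot> z X Y = f \<cdot> z X Y" using comp_add[OF f 0 0] add_zero[OF 0] by simp
  then show ?thesis using add_eq_self_iff hom_comp[OF f 0] by blast
qed

lemma zero_comp: "\<lbrakk>f \<in> Hom C X Y; W \<in> Obj C\<rbrakk> \<Longrightarrow> z Y W \<cdot> f = z X W"
proof -
  assume f: "f \<in> Hom C X Y" and W: "W \<in> Obj C"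
  have 0: "z Y W \<in> Hom C Y W" using hom_obj[OF f] W by simp
  have "z Y W \<cdot> f \<oplus> z Y W \<cdot> f = z Y W \<cdot> f" using add_comp[OF 0 0 f] add_zero[OF 0] by simp
  then show ?thesis using add_eq_self_iff hom_comp[OF 0 f] by blast
qed

text \<open>A difference, carrying exactly what is needed to reduce \<open>f = g\<close> to \<open>d = 0\<close> after
  composition on either side.\<close>

lemma difference:
  assumes "f \<in> Hom C X Y" "g \<in> Hom C X Y"
  obtains d where "d \<in> Hom C X Y" "d = z X Y \<longleftrightarrow> f = g" "d \<oplus> g = f"
    "\<And>W a. a \<in> Hom C W X \<Longrightarrow> d \<cdot> a = z W Y \<longleftrightarrow> f \<cdot> a = g \<cdot> a"
    "\<And>W a. a \<in> Hom C Y W \<Longrightarrow> a \<cdot> d = z X W \<longleftrightarrow> a \<cdot> f = a \<cdot> g"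
proof -
  obtain d where d: "d \<in> Hom C X Y" and f: "d \<oplus> g = f" using ex_diff assms by blast
  show ?thesis
  proof (rule that[OF d _ f])
    show "d = z X Y \<longleftrightarrow> f = g" using add_eq_self_iff[OF assms(2) d] f by simp
    show "d \<cdot> a = z W Y \<longleftrightarrow> f \<cdot> a = g \<cdot> a" if a: "a \<in> Hom C W X" for W a
      using add_eq_self_iff[OF hom_comp[OF assms(2) a] hom_comp[OF d a]]
      unfolding add_comp[OF d assms(2) a, symmetric] f by (rule sym)
    show "a \<cdot> d = z X W \<longleftrightarrow> a \<cdot> f = a \<cdot> g" if a: "a \<in> Hom C Y W" for W a
      using add_eq_self_iff[OF hom_comp[OF a assms(2)] hom_comp[OF a d]]
      unfolding comp_add[OF a d assms(2), symmetric] f by (rule sym)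
  qed
qed

text \<open>The redundant object conditions on the right let the simplifier discharge the side
  conditions of the identity and zero laws.\<close>

lemma Hom_iff:
  "f \<in> Hom C X Y \<longleftrightarrow> f \<in> Arr C \<and> Dom C f = X \<and> Cod C f = Y \<and> X \<in> Obj C \<and> Y \<in> Obj C"
  by (auto simp: Hom_def)

text \<open>Simplification nests composites to the right, where a known equation for
  \<open>g \<cdot> f\<close> no longer matches \<open>g \<cdot> (f \<cdot> a)\<close>. This form
  restores the match.\<close>

lemma reassoc:
  "\<lbrakk>g \<cdot> f = k; g \<in> Arr C; f \<in> Arr C; a \<in> Arr C; Cod C a = Dom C f; Cod C f = Dom C g\<rbrakk>
    \<Longrightarrow> g \<cdot> (f \<cdot> a) = k \<cdot> a"
  using comp_assoc by metis

lemma zero_arr_simps [simp]: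
  "\<lbrakk>X \<in> Obj C; Y \<in> Obj C\<rbrakk> \<Longrightarrow> z X Y \<in> Arr C"
  "\<lbrakk>X \<in> Obj C; Y \<in> Obj C\<rbrakk> \<Longrightarrow> Dom C (z X Y) = X"
  "\<lbrakk>X \<in> Obj C; Y \<in> Obj C\<rbrakk> \<Longrightarrow> Cod C (z X Y) = Y"
  "\<lbrakk>f \<in> Arr C; Dom C f = Y; X \<in> Obj C\<rbrakk> \<Longrightarrow> f \<cdot> z X Y = z X (Cod C f)"
  "\<lbrakk>f \<in> Arr C; Cod C f = Y; X \<in> Obj C\<rbrakk> \<Longrightarrow> z Y X \<cdot> f = z (Dom C f) X"
  using zero_hom[of X Y] comp_zero[of f Y "Cod C f" X] zero_comp[of f "Dom C f" Y X]
  by (auto simp: Hom_def)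

section \<open>Zero arrows, kernels and cokernels\<close>

lemma zero_obj_hom_unique:
  "\<lbrakk>zero_obj C Z; a \<in> Hom C X Z; b \<in> Hom C X Z\<rbrakk> \<Longrightarrow> a = b"
  "\<lbrakk>zero_obj C Z; a \<in> Hom C Z X; b \<in> Hom C Z X\<rbrakk> \<Longrightarrow> a = b"
  unfolding zero_obj_def using hom_obj by metis+

lemma ex_zero_obj: obtains Z where "zero_obj C Z" "Z \<in> Obj C"
  using abelian by (auto simp: abelian_def zero_obj_def)

lemma zero_objI: "X \<in> Obj C \<Longrightarrow> Ident C X = z X X \<Longrightarrow> zero_obj C X"
proof -
  assume X: "X \<in> Obj C" and 0: "Ident C X = z X X"
  have "f = z Y X" if "f \<in> Hom C Y X" for f Y using that X 0 hom_ident(2) zero_comp by metis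
  moreover have "f = z X Y" if "f \<in> Hom C X Y" for f Y using that X 0 hom_ident(1) comp_zero by metis
  ultimately show ?thesis unfolding zero_obj_def using X zero_hom by metis
qed

text \<open>Links the addition-free notion of the definitions to the unit of the hom-group: an arrow
  into a zero object is unique, so it equals that unit, and composing it further keeps it
  zero.\<close>

lemma zero_arr_iff: "f \<in> Hom C X Y \<Longrightarrow> zero_arr C f \<longleftrightarrow> f = z X Y"
proof
  assume f: "f \<in> Hom C X Y"
  {
    assume "zero_arr C f"
    then obtain Z a b where Z: "zero_obj C Z" and a: "a \<in> Hom C X Z" and b: "b \<in> Hom C Z Y"
      and ba: "f = b \<cdot> a"
      unfolding zero_arr_def hom_dom[OF f] hom_cod[OF f] by blast
    have "a = z X Z"
      using zero_obj_hom_unique(1)[OF Z a zero_hom[OF hom_obj[OF a]]] .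
    then show "f = z X Y" using ba comp_zero[OF b hom_obj(1)[OF a]] by simp
  }
  assume "f = z X Y"
  obtain Z where Z: "zero_obj C Z" "Z \<in> Obj C" by (rule ex_zero_obj)
  have "z Z Y \<cdot> z X Z = z X Y" using Z hom_obj[OF f] comp_zero[OF zero_hom] by blast
  moreover have "z X Z \<in> Hom C X Z" "z Z Y \<in> Hom C Z Y" using Z hom_obj[OF f] by simp_all
  ultimately show "zero_arr C f"
    unfolding zero_arr_def hom_dom[OF f] hom_cod[OF f] using Z(1) \<open>f = z X Y\<close> by metis
qed

text \<open>Two arrows that \<open>m\<close> identifies differ by an arrow that \<open>m\<close>
  kills, so cancellation need only be tested on zero.\<close>

lemma mono_iff:
  assumes "m \<in> Hom C X Y"
  shows "mono_arr C m \<longleftrightarrow> (\<forall>W. \<forall>a\<in>Hom C W X. m \<cdot> a = z W Y \<longrightarrow> a = z W X)"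
proof
  assume m: "mono_arr C m"
  show "\<forall>W. \<forall>a\<in>Hom C W X. m \<cdot> a = z W Y \<longrightarrow> a = z W X"
  proof (intro allI ballI impI)
    fix W a assume a: "a \<in> Hom C W X" "m \<cdot> a = z W Y"
    have "z W X \<in> Hom C W X" "m \<cdot> z W X = m \<cdot> a"
      using a assms hom_obj comp_zero by auto
    then show "a = z W X" using m a assms unfolding mono_arr_def Hom_def by auto
  qed
next
  assume *: "\<forall>W. \<forall>a\<in>Hom C W X. m \<cdot> a = z W Y \<longrightarrow> a = z W X"
  have "a = b" if ab: "a \<in> Hom C W X" "b \<in> Hom C W X" "m \<cdot> a = m \<cdot> b" for W a b
  proof -
    obtain d where "d \<in> Hom C W X" "d = z W X \<longleftrightarrow> a = b" "m \<cdot> d = z W Y \<longleftrightarrow> m \<cdot> a = m \<cdot> b"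
      using difference[OF ab(1,2)] assms by metis
    with * ab(3) show ?thesis by blast
  qed
  then show "mono_arr C m" using assms unfolding mono_arr_def Hom_def by auto
qed

lemma epi_iff:
  assumes "e \<in> Hom C X Y"
  shows "epi_arr C e \<longleftrightarrow> (\<forall>W. \<forall>a\<in>Hom C Y W. a \<cdot> e = z X W \<longrightarrow> a = z Y W)"
proof
  assume m: "epi_arr C e"
  show "\<forall>W. \<forall>a\<in>Hom C Y W. a \<cdot> e = z X W \<longrightarrow> a = z Y W"
  proof (intro allI ballI impI)
    fix W a assume a: "a \<in> Hom C Y W" "a \<cdot> e = z X W"
    have "z Y W \<in> Hom C Y W" "z Y W \<cdot> e = a \<cdot> e"
      using a assms hom_obj zero_comp by auto
    then show "a = z Y W" using m a assms unfolding epi_arr_def Hom_def by auto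
  qed
next
  assume *: "\<forall>W. \<forall>a\<in>Hom C Y W. a \<cdot> e = z X W \<longrightarrow> a = z Y W"
  have "a = b" if ab: "a \<in> Hom C Y W" "b \<in> Hom C Y W" "a \<cdot> e = b \<cdot> e" for W a b
  proof -
    obtain d where "d \<in> Hom C Y W" "d = z Y W \<longleftrightarrow> a = b" "d \<cdot> e = z X W \<longleftrightarrow> a \<cdot> e = b \<cdot> e"
      using difference[OF ab(1,2)] assms by metis
    with * ab(3) show ?thesis by blast
  qed
  then show "epi_arr C e" using assms unfolding epi_arr_def Hom_def by auto
qed

lemma mono_cancel:
  "\<lbrakk>mono_arr C m; m \<in> Hom C X Y; a \<in> Hom C W X; b \<in> Hom C W X; m \<cdot> a = m \<cdot> b\<rbrakk> \<Longrightarrow> a = b"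
  unfolding mono_arr_def Hom_def by auto

lemma epi_cancel:
  "\<lbrakk>epi_arr C e; e \<in> Hom C X Y; a \<in> Hom C Y W; b \<in> Hom C Y W; a \<cdot> e = b \<cdot> e\<rbrakk> \<Longrightarrow> a = b"
  unfolding epi_arr_def Hom_def by auto

lemma mono_zero: "\<lbrakk>mono_arr C m; m \<in> Hom C X Y; a \<in> Hom C W X; m \<cdot> a = z W Y\<rbrakk> \<Longrightarrow> a = z W X"
  using mono_iff by blast

lemma epi_zero: "\<lbrakk>epi_arr C e; e \<in> Hom C X Y; a \<in> Hom C Y W; a \<cdot> e = z X W\<rbrakk> \<Longrightarrow> a = z Y W"
  using epi_iff by blast

text \<open>The uniqueness clause of the definition turns into monicity of \<open>k\<close>: if
  \<open>k \<cdot> a = 0\<close>, then \<open>a\<close> and the zero arrow are two factorizations of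
  the same arrow.\<close>

lemma is_kernel_iff:
  assumes k: "k \<in> Hom C K X" and f: "f \<in> Hom C X Y"
  shows "is_kernel C k f \<longleftrightarrow> mono_arr C k \<and> f \<cdot> k = z K Y \<and>
    (\<forall>W. \<forall>g\<in>Hom C W X. f \<cdot> g = z W Y \<longrightarrow> (\<exists>u\<in>Hom C W K. k \<cdot> u = g))"
    (is "_ \<longleftrightarrow> ?R")
proof
  have fk: "f \<cdot> k \<in> Hom C K Y" using k f by blast
  {
    assume ker: "is_kernel C k f"
    have 0: "f \<cdot> k = z K Y" using ker zero_arr_iff[OF fk] by (simp add: is_kernel_def)
    have u: "\<exists>!u. u \<in> Hom C W K \<and> k \<cdot> u = g" if "g \<in> Hom C W X" "f \<cdot> g = z W Y" for W g
    proof -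
      have "zero_arr C (f \<cdot> g)" using that f zero_arr_iff[of "f \<cdot> g" W Y] hom_comp by metis
      then have "\<exists>!u. u \<in> Hom C (Dom C g) (Dom C k) \<and> k \<cdot> u = g"
        using ker hom_arr[OF that(1)] hom_cod[OF that(1)] hom_dom[OF f] unfolding is_kernel_def by metis
      then show ?thesis unfolding hom_dom[OF that(1)] hom_dom[OF k] .
    qed
    have "a = z W K" if "a \<in> Hom C W K" "k \<cdot> a = z W X" for W a
    proof -
      have "f \<cdot> (k \<cdot> a) = z W Y" "k \<cdot> a \<in> Hom C W X" "z W K \<in> Hom C W K" "k \<cdot> z W K = k \<cdot> a"
        using that k f comp_zero hom_obj by auto
      then show ?thesis using u that(1) by blast
    qed
    then have "mono_arr C k" using mono_iff[OF k] by blast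
    with 0 u show ?R by blast
  }
  assume R: ?R
  show "is_kernel C k f" unfolding is_kernel_def
  proof (intro conjI ballI impI)
    show "zero_arr C (f \<cdot> k)" using R zero_arr_iff fk by blast
    fix g assume g: "g \<in> Arr C" "Cod C g = Dom C f" "zero_arr C (f \<cdot> g)"
    then have g': "g \<in> Hom C (Dom C g) X" using f by (simp add: Hom_def)
    then have "f \<cdot> g = z (Dom C g) Y" using g(3) f zero_arr_iff by blast
    then obtain u where "u \<in> Hom C (Dom C g) K" "k \<cdot> u = g" using R g' by blast
    then show "\<exists>!u. u \<in> Hom C (Dom C g) (Dom C k) \<and> k \<cdot> u = g"
      using R k mono_cancel hom_dom by metis
  qed (use k f in \<open>auto simp: Hom_def\<close>)
qed

lemma is_cokernel_iff:
  assumes c: "c \<in> Hom C Y Q" and f: "f \<in> Hom C X Y"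
  shows "is_cokernel C c f \<longleftrightarrow> epi_arr C c \<and> c \<cdot> f = z X Q \<and>
    (\<forall>W. \<forall>g\<in>Hom C Y W. g \<cdot> f = z X W \<longrightarrow> (\<exists>u\<in>Hom C Q W. u \<cdot> c = g))"
    (is "_ \<longleftrightarrow> ?R")
proof
  have cf: "c \<cdot> f \<in> Hom C X Q" using c f by blast
  {
    assume ker: "is_cokernel C c f"
    have 0: "c \<cdot> f = z X Q" using ker zero_arr_iff[OF cf] by (simp add: is_cokernel_def)
    have u: "\<exists>!u. u \<in> Hom C Q W \<and> u \<cdot> c = g" if "g \<in> Hom C Y W" "g \<cdot> f = z X W" for W g
    proof -
      have "zero_arr C (g \<cdot> f)" using that f zero_arr_iff[of "g \<cdot> f" X W] hom_comp by metis
      then have "\<exists>!u. u \<in> Hom C (Cod C c) (Cod C g) \<and> u \<cdot> c = g"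
        using ker hom_arr[OF that(1)] hom_dom[OF that(1)] hom_cod[OF f] unfolding is_cokernel_def by metis
      then show ?thesis unfolding hom_cod[OF that(1)] hom_cod[OF c] .
    qed
    have "a = z Q W" if "a \<in> Hom C Q W" "a \<cdot> c = z Y W" for W a
    proof -
      have "(a \<cdot> c) \<cdot> f = z X W" "a \<cdot> c \<in> Hom C Y W" "z Q W \<in> Hom C Q W" "z Q W \<cdot> c = a \<cdot> c"
        using that c f zero_comp hom_obj by auto
      then show ?thesis using u that(1) by blast
    qed
    then have "epi_arr C c" using epi_iff[OF c] by blast
    with 0 u show ?R by blast
  }
  assume R: ?R
  show "is_cokernel C c f" unfolding is_cokernel_def
  proof (intro conjI ballI impI)
    show "zero_arr C (c \<cdot> f)" using R zero_arr_iff cf by blast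
    fix g assume g: "g \<in> Arr C" "Dom C g = Cod C f" "zero_arr C (g \<cdot> f)"
    then have g': "g \<in> Hom C Y (Cod C g)" using f by (simp add: Hom_def)
    then have "g \<cdot> f = z X (Cod C g)" using g(3) f zero_arr_iff by blast
    then obtain u where "u \<in> Hom C Q (Cod C g)" "u \<cdot> c = g" using R g' by blast
    then show "\<exists>!u. u \<in> Hom C (Cod C c) (Cod C g) \<and> u \<cdot> c = g"
      using R c epi_cancel hom_cod by metis
  qed (use c f in \<open>auto simp: Hom_def\<close>)
qed

lemma ex_kernel:
  assumes "f \<in> Hom C X Y"
  obtains K k where "k \<in> Hom C K X" "is_kernel C k f"
proof -
  obtain k where "is_kernel C k f" using abelian assms hom_arr unfolding abelian_def by blast
  then show ?thesis using that[of k "Dom C k"] assms by (auto simp: is_kernel_def Hom_def)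
qed

lemma ex_cokernel:
  assumes "f \<in> Hom C X Y"
  obtains Q c where "c \<in> Hom C Y Q" "is_cokernel C c f"
proof -
  obtain c where "is_cokernel C c f" using abelian assms hom_arr unfolding abelian_def by blast
  then show ?thesis using that[of c "Cod C c"] assms by (auto simp: is_cokernel_def Hom_def)
qed

text \<open>\<open>m\<close> is the kernel of some \<open>g\<close>. As \<open>g\<close> kills
  \<open>m\<close>, it factors through the cokernel \<open>c\<close>; hence whatever
  \<open>c\<close> kills is killed by \<open>g\<close> and factors through \<open>m\<close>.\<close>

lemma mono_kernel_of_cokernel:
  assumes m: "mono_arr C m" "m \<in> Hom C X Y" and c: "is_cokernel C c m" "c \<in> Hom C Y Q"
  shows "is_kernel C m c"
proof -
  obtain g where g: "is_kernel C m g" using m abelian unfolding abelian_def by blast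
  then obtain W where gh: "g \<in> Hom C Y W" using m by (auto simp: is_kernel_def Hom_def)
  note G = is_kernel_iff[THEN iffD1, OF m(2) gh g]
  note c' = is_cokernel_iff[THEN iffD1, OF c(2) m(2) c(1)]
  obtain u where u: "u \<in> Hom C Q W" "u \<cdot> c = g" using c' G gh by blast
  have "\<exists>v\<in>Hom C V X. m \<cdot> v = a" if "a \<in> Hom C V Y" "c \<cdot> a = z V Q" for V a
  proof -
    have "g \<cdot> a = z V W" using u(1) c(2) that by (simp add: Hom_iff flip: u(2))
    then show ?thesis using G that by blast
  qed
  then show ?thesis using is_kernel_iff[OF m(2) c(2)] m c' by blast
qed

lemma epi_cokernel_of_kernel:
  assumes m: "epi_arr C e" "e \<in> Hom C X Y" and k: "is_kernel C k e" "k \<in> Hom C K X"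
  shows "is_cokernel C e k"
proof -
  obtain g where g: "is_cokernel C e g" using m abelian unfolding abelian_def by blast
  then obtain W where gh: "g \<in> Hom C W X" using m by (auto simp: is_cokernel_def Hom_def)
  note G = is_cokernel_iff[THEN iffD1, OF m(2) gh g]
  note k' = is_kernel_iff[THEN iffD1, OF k(2) m(2) k(1)]
  obtain u where u: "u \<in> Hom C W K" "k \<cdot> u = g" using k' G gh by blast
  have "\<exists>v\<in>Hom C Y V. v \<cdot> e = a" if "a \<in> Hom C X V" "a \<cdot> k = z K V" for V a
  proof -
    have "a \<cdot> g = z W V" using u(1) k(2) that(1) by (simp add: Hom_iff reassoc[OF that(2)] flip: u(2))
    then show ?thesis using G that by blast
  qed
  then show ?thesis using is_cokernel_iff[OF m(2) k(2)] m k' by blast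
qed

lemma iso_of_mono_section:
  assumes "mono_arr C m" "m \<in> Hom C X Y" "u \<in> Hom C Y X" "m \<cdot> u = Ident C Y"
  shows "iso_arr C m"
proof -
  have X: "X \<in> Obj C" using assms hom_obj by blast
  have "m \<cdot> (u \<cdot> m) = m \<cdot> Ident C X" using assms(2,3) by (simp add: Hom_iff reassoc[OF assms(4)])
  then have "u \<cdot> m = Ident C X"
    using mono_cancel[OF assms(1,2) hom_comp[OF assms(3,2)] ident_hom[OF X]] by blast
  then show ?thesis using assms by (auto simp: iso_arr_def Hom_def)
qed

section \<open>Biproducts, pullbacks and images\<close>

definition biproduct :: "'o \<Rightarrow> 'o \<Rightarrow> 'o \<Rightarrow> 'm \<Rightarrow> 'm \<Rightarrow> 'm \<Rightarrow> 'm \<Rightarrow> bool" where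
  "biproduct X Y P p q i j \<longleftrightarrow> p \<in> Hom C P X \<and> q \<in> Hom C P Y \<and> i \<in> Hom C X P \<and> j \<in> Hom C Y P \<and>
     p \<cdot> i = Ident C X \<and> q \<cdot> j = Ident C Y \<and> p \<cdot> j = z Y X \<and> q \<cdot> i = z X Y \<and>
     i \<cdot> p \<oplus> j \<cdot> q = Ident C P"

lemma biproduct_eqI:
  assumes "biproduct X Y P p q i j" "a \<in> Hom C W P" "b \<in> Hom C W P" "p \<cdot> a = p \<cdot> b" "q \<cdot> a = q \<cdot> b"
  shows "a = b"
proof -
  have *: "c = i \<cdot> (p \<cdot> c) \<oplus> j \<cdot> (q \<cdot> c)" if "c \<in> Hom C W P" for c
  proof -
    have "c = (i \<cdot> p \<oplus> j \<cdot> q) \<cdot> c" using assms(1) that hom_ident(2) by (simp add: biproduct_def)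
    also have "\<dots> = (i \<cdot> p) \<cdot> c \<oplus> (j \<cdot> q) \<cdot> c"
      using add_comp assms(1) that hom_comp unfolding biproduct_def by blast
    finally show ?thesis using assms(1) that unfolding biproduct_def by (simp add: Hom_iff)
  qed
  show ?thesis using *[OF assms(2)] *[OF assms(3)] assms(4,5) by simp
qed

lemma biproduct_coeqI:
  assumes "biproduct X Y P p q i j" "a \<in> Hom C P W" "b \<in> Hom C P W" "a \<cdot> i = b \<cdot> i" "a \<cdot> j = b \<cdot> j"
  shows "a = b"
proof -
  have *: "c = (c \<cdot> i) \<cdot> p \<oplus> (c \<cdot> j) \<cdot> q" if "c \<in> Hom C P W" for c
  proof -
    have "c = c \<cdot> (i \<cdot> p \<oplus> j \<cdot> q)" using assms(1) that hom_ident(1) by (simp add: biproduct_def)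
    also have "\<dots> = c \<cdot> (i \<cdot> p) \<oplus> c \<cdot> (j \<cdot> q)"
      using comp_add assms(1) that hom_comp unfolding biproduct_def by blast
    finally show ?thesis using assms(1) that unfolding biproduct_def by (simp add: Hom_iff)
  qed
  show ?thesis using *[OF assms(2)] *[OF assms(3)] assms(4,5) by simp
qed

lemma biproduct_pair:
  assumes B: "biproduct X Y P p q i j" and a: "a \<in> Hom C W X" and b: "b \<in> Hom C W Y"
  obtains u where "u \<in> Hom C W P" "p \<cdot> u = a" "q \<cdot> u = b"
proof
  note B' = B[unfolded biproduct_def]
  have h: "i \<cdot> a \<in> Hom C W P" "j \<cdot> b \<in> Hom C W P" using B' a b by auto
  show "i \<cdot> a \<oplus> j \<cdot> b \<in> Hom C W P" using h by auto
  have o: "W \<in> Obj C" "X \<in> Obj C" "Y \<in> Obj C" using a b hom_obj by auto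
  have "p \<cdot> (i \<cdot> a) = a" "p \<cdot> (j \<cdot> b) = z W X"
    using B' a b by (simp_all add: Hom_iff reassoc)
  then show "p \<cdot> (i \<cdot> a \<oplus> j \<cdot> b) = a" using comp_add[OF _ h, of p X] B' add_zero a by simp
  have "q \<cdot> (i \<cdot> a) = z W Y" "q \<cdot> (j \<cdot> b) = b"
    using B' a b by (simp_all add: Hom_iff reassoc)
  then show "q \<cdot> (i \<cdot> a \<oplus> j \<cdot> b) = b" using comp_add[OF _ h, of q Y] B' zero_add b by simp
qed

text \<open>The definition of \<open>abelian\<close> provides only projections. The injections are
  induced by the pairs (1, 0) and (0, 1), and \<open>i \<cdot> p \<oplus> j \<cdot> q\<close> is the
  identity because both have the same projections.\<close>

lemma ex_biproduct:
  assumes X: "X \<in> Obj C" and Y: "Y \<in> Obj C"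
  obtains P p q i j where "biproduct X Y P p q i j"
proof -
  obtain p q where pq: "is_product C X Y p q" using abelian X Y unfolding abelian_def by blast
  define P where "P = Dom C p"
  have p: "p \<in> Hom C P X" and q: "q \<in> Hom C P Y" using pq by (auto simp: P_def is_product_def Hom_def)
  have U: "\<exists>!u. u \<in> Hom C W P \<and> p \<cdot> u = a \<and> q \<cdot> u = b" if "a \<in> Hom C W X" "b \<in> Hom C W Y" for W a b
  proof -
    have "\<exists>!u. u \<in> Hom C (Dom C a) (Dom C p) \<and> p \<cdot> u = a \<and> q \<cdot> u = b"
      using pq hom_arr[OF that(1)] hom_arr[OF that(2)] hom_dom[OF that(1)] hom_dom[OF that(2)]
        hom_cod[OF that(1)] hom_cod[OF that(2)] unfolding is_product_def by metis
    then show ?thesis unfolding hom_dom[OF that(1)] P_def .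
  qed
  obtain i where i: "i \<in> Hom C X P" "p \<cdot> i = Ident C X" "q \<cdot> i = z X Y"
    using U[of "Ident C X" X "z X Y"] X Y by auto
  obtain j where j: "j \<in> Hom C Y P" "p \<cdot> j = z Y X" "q \<cdot> j = Ident C Y"
    using U[of "z Y X" Y "Ident C Y"] X Y by auto
  have P: "P \<in> Obj C" using hom_obj p by blast
  have h: "i \<cdot> p \<in> Hom C P P" "j \<cdot> q \<in> Hom C P P" using i j p q by auto
  have "p \<cdot> (i \<cdot> p) = p" "p \<cdot> (j \<cdot> q) = z P X" "q \<cdot> (i \<cdot> p) = z P Y" "q \<cdot> (j \<cdot> q) = q"
    using i j p q by (simp_all add: Hom_iff reassoc)
  then have "p \<cdot> (i \<cdot> p \<oplus> j \<cdot> q) = p" "q \<cdot> (i \<cdot> p \<oplus> j \<cdot> q) = q"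
    using comp_add[OF p h] comp_add[OF q h] add_zero[OF p] zero_add[OF q] by auto
  moreover have "p \<cdot> Ident C P = p" "q \<cdot> Ident C P = q" using p q hom_ident by auto
  ultimately have "i \<cdot> p \<oplus> j \<cdot> q = Ident C P"
    using U[OF p q] P add_hom[OF h] ident_hom[OF P] by blast
  then have "biproduct X Y P p q i j" using p q i j by (simp add: biproduct_def)
  then show ?thesis by (rule that)
qed

text \<open>The pullback is the kernel of the difference \<open>d\<close> of
  \<open>f \<cdot> p\<close> and \<open>g \<cdot> q\<close> on the biproduct. Joint monicity of the
  two legs is stated as a test on zero, the form in which it is applied.\<close>

lemma pullback:
  assumes f: "f \<in> Hom C X V" and g: "g \<in> Hom C Y V"
  obtains P p q where "p \<in> Hom C P X" "q \<in> Hom C P Y" "f \<cdot> p = g \<cdot> q"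
    "\<And>W a. \<lbrakk>a \<in> Hom C W P; p \<cdot> a = z W X; q \<cdot> a = z W Y\<rbrakk> \<Longrightarrow> a = z W P"
    "\<And>W a b. \<lbrakk>a \<in> Hom C W X; b \<in> Hom C W Y; f \<cdot> a = g \<cdot> b\<rbrakk> \<Longrightarrow> \<exists>u\<in>Hom C W P. p \<cdot> u = a \<and> q \<cdot> u = b"
    "epi_arr C f \<Longrightarrow> epi_arr C q"
proof -
  obtain B p q i j where B: "biproduct X Y B p q i j" using ex_biproduct[OF hom_obj(1)[OF f] hom_obj(1)[OF g]] .
  note B' = B[unfolded biproduct_def]
  have fp: "f \<cdot> p \<in> Hom C B V" and gq: "g \<cdot> q \<in> Hom C B V" using f g B' by auto
  obtain d where d: "d \<in> Hom C B V"
      "d = z B V \<longleftrightarrow> f \<cdot> p = g \<cdot> q" "d \<oplus> g \<cdot> q = f \<cdot> p"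
      "\<And>W a. a \<in> Hom C W B \<Longrightarrow> d \<cdot> a = z W V \<longleftrightarrow> (f \<cdot> p) \<cdot> a = (g \<cdot> q) \<cdot> a"
      "\<And>W a. a \<in> Hom C V W \<Longrightarrow> a \<cdot> d = z B W \<longleftrightarrow> a \<cdot> (f \<cdot> p) = a \<cdot> (g \<cdot> q)"
    by (rule difference[OF fp gq]) blast
  have d2: "d \<cdot> a = z W V \<longleftrightarrow> f \<cdot> (p \<cdot> a) = g \<cdot> (q \<cdot> a)" if "a \<in> Hom C W B" for W a
    using d(4)[OF that] that f g B' by (simp add: Hom_iff)
  obtain P k where k: "k \<in> Hom C P B" "is_kernel C k d" using ex_kernel d(1) by blast
  note K = is_kernel_iff[THEN iffD1, OF k(1) d(1) k(2)]
  show ?thesis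
  proof
    show pk: "p \<cdot> k \<in> Hom C P X" and qk: "q \<cdot> k \<in> Hom C P Y" using B' k by auto
    show "f \<cdot> (p \<cdot> k) = g \<cdot> (q \<cdot> k)" using K d2 k by blast
    show "a = z W P" if a: "a \<in> Hom C W P" "(p \<cdot> k) \<cdot> a = z W X" "(q \<cdot> k) \<cdot> a = z W Y" for W a
    proof -
      have W: "W \<in> Obj C" "B \<in> Obj C" using a k hom_obj by auto
      have "p \<cdot> (k \<cdot> a) = p \<cdot> z W B" "q \<cdot> (k \<cdot> a) = q \<cdot> z W B"
        using a k B' by (simp_all add: Hom_iff)
      then have "k \<cdot> a = z W B" using biproduct_eqI[OF B hom_comp[OF k(1) a(1)] zero_hom[OF W]] by blast
      then show ?thesis using K mono_zero k a by blast
    qed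
    show "\<exists>u\<in>Hom C W P. (p \<cdot> k) \<cdot> u = a \<and> (q \<cdot> k) \<cdot> u = b"
      if ab: "a \<in> Hom C W X" "b \<in> Hom C W Y" "f \<cdot> a = g \<cdot> b" for W a b
    proof -
      obtain v where v: "v \<in> Hom C W B" "p \<cdot> v = a" "q \<cdot> v = b" using biproduct_pair[OF B ab(1,2)] by blast
      then obtain u where u: "u \<in> Hom C W P" "k \<cdot> u = v" using K d2 ab(3) by blast
      then show ?thesis using v B' k by (intro bexI[of _ u]) (simp_all add: Hom_iff)
    qed
    show "epi_arr C (q \<cdot> k)" if e: "epi_arr C f"
    proof -
      have "b = z Y W" if b: "b \<in> Hom C Y W" "b \<cdot> (q \<cdot> k) = z P W" for W b
      proof -
        have o: "X \<in> Obj C" "W \<in> Obj C" "V \<in> Obj C" using b f hom_obj by auto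
        have "d \<cdot> i \<oplus> (g \<cdot> q) \<cdot> i = (f \<cdot> p) \<cdot> i" using add_comp[OF d(1) gq, of i X, symmetric] d(3) B' by simp
        moreover have "(g \<cdot> q) \<cdot> i = z X V" using g B' o by (simp add: Hom_iff)
        moreover have "(f \<cdot> p) \<cdot> i = f" using f B' by (simp add: Hom_iff)
        ultimately have di: "d \<cdot> i = f" using add_zero[OF hom_comp[OF d(1)]] B' by simp
        have "c = z V U" if c: "c \<in> Hom C V U" "c \<cdot> d = z B U" for U c
        proof -
          have "c \<cdot> f = z X U" using c(1) d(1) B' by (simp add: Hom_iff reassoc[OF c(2)] flip: di)
          then show ?thesis using epi_zero[OF e f c(1)] by blast
        qed
        then have "epi_arr C d" using epi_iff[OF d(1)] by blast
        \<comment> \<open>An epimorphism is the cokernel of its kernel, so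
          \<open>b \<cdot> q\<close>, which vanishes on \<open>k\<close>, factors through
          \<open>d\<close> as \<open>c \<cdot> d\<close>. Restricting to the first summand, where
          \<open>q\<close> vanishes and \<open>d\<close> is \<open>f\<close>, gives
          \<open>c \<cdot> f = 0\<close> and thus \<open>c = 0\<close>; restricting to the second
          then gives \<open>b = 0\<close>.\<close>
        then have "is_cokernel C d k" using epi_cokernel_of_kernel d(1) k by blast
        moreover have "(b \<cdot> q) \<cdot> k = z P W" using b B' k by (simp add: Hom_iff)
        moreover have bq: "b \<cdot> q \<in> Hom C B W" using b B' by blast
        ultimately obtain c where c: "c \<in> Hom C V W" "c \<cdot> d = b \<cdot> q"
          using is_cokernel_iff[OF d(1) k(1)] by blast
        have "c \<cdot> f = (b \<cdot> q) \<cdot> i" using c(1) d(1) B' by (simp add: Hom_iff reassoc[OF c(2)] flip: di)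
        also have "\<dots> = z X W" using b o B' by (simp add: Hom_iff)
        finally have "c = z V W" using epi_zero[OF e f c(1)] by blast
        then have "b \<cdot> q = z B W" using c d(1) o by (simp add: Hom_iff)
        then have "(b \<cdot> q) \<cdot> j = z Y W" using B' o by (simp add: Hom_iff)
        then show ?thesis using b B' by (simp add: Hom_iff)
      qed
      then show ?thesis using epi_iff[OF qk] by blast
    qed
  qed
qed

lemma kernel_facts:
  assumes "is_kernel C k f" "k \<in> Hom C K X" "f \<in> Hom C X Y"
  shows "mono_arr C k" "f \<cdot> k = z K Y"
    "\<And>W g. g \<in> Hom C W X \<Longrightarrow> f \<cdot> g = z W Y \<Longrightarrow> \<exists>u\<in>Hom C W K. k \<cdot> u = g"
  using is_kernel_iff[OF assms(2,3)] assms(1) by blast+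

lemma cokernel_facts:
  assumes "is_cokernel C c f" "c \<in> Hom C Y Q" "f \<in> Hom C X Y"
  shows "epi_arr C c" "c \<cdot> f = z X Q"
    "\<And>W g. g \<in> Hom C Y W \<Longrightarrow> g \<cdot> f = z X W \<Longrightarrow> \<exists>u\<in>Hom C Q W. u \<cdot> c = g"
  using is_cokernel_iff[OF assms(2,3)] assms(1) by blast+

text \<open>For monicity, an arrow \<open>a\<close> killed by \<open>m\<close> need not lift along
  \<open>q\<close>, but it does after the epimorphism \<open>r\<close> obtained by pulling
  \<open>q\<close> back. The lift is killed by \<open>f\<close>, hence comes from the kernel and
  dies under \<open>q\<close>; so \<open>a \<cdot> r = 0\<close>.\<close>

lemma ex_mono_epi_factorization:
  assumes f: "f \<in> Hom C X Y" and k: "is_kernel C k f" "k \<in> Hom C K X"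
    and q: "is_cokernel C q k" "q \<in> Hom C X I"
  obtains m where "m \<in> Hom C I Y" "mono_arr C m" "m \<cdot> q = f"
proof -
  note k' = kernel_facts[OF k f]
  note q' = cokernel_facts[OF q k(2)]
  obtain m where m: "m \<in> Hom C I Y" "m \<cdot> q = f" using q'(3)[OF f k'(2)] by blast
  have "a = z W I" if a: "a \<in> Hom C W I" "m \<cdot> a = z W Y" for W a
  proof -
    obtain P p r where p: "p \<in> Hom C P X" and r: "r \<in> Hom C P W" and pr: "q \<cdot> p = a \<cdot> r"
      and "epi_arr C q \<Longrightarrow> epi_arr C r"
      using pullback[OF q(2) a(1)] by metis
    then have e: "epi_arr C r" using q'(1) by blast
    have "m \<cdot> (a \<cdot> r) = z P Y" using m(1) a(1) r by (simp add: Hom_iff reassoc[OF a(2)])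
    then have "f \<cdot> p = z P Y" using m(1) q(2) p by (simp add: Hom_iff pr flip: m(2))
    then obtain u where u: "u \<in> Hom C P K" "k \<cdot> u = p" using k'(3) p by blast
    have "q \<cdot> p = z P I" using u(1) k(2) q(2) by (simp add: Hom_iff reassoc[OF q'(2)] flip: u(2))
    then show ?thesis using epi_zero[OF e r a(1)] pr by simp
  qed
  then have "mono_arr C m" using mono_iff[OF m(1)] by blast
  then show ?thesis using that m by blast
qed

section \<open>Short exact sequences and Ext\<close>

lemma short_exact_biproduct:
  assumes B: "biproduct X D E p r s i"
  shows "short_exact C i p"
proof -
  note B' = B[unfolded biproduct_def]
  have i: "i \<in> Hom C D E" and p: "p \<in> Hom C E X" and r: "r \<in> Hom C E D" and s: "s \<in> Hom C X E"
    and pi: "p \<cdot> i = z D X" and ri: "r \<cdot> i = Ident C D" and ps: "p \<cdot> s = Ident C X"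
    using B' by auto
  have "a = z W D" if a: "a \<in> Hom C W D" "i \<cdot> a = z W E" for W a
  proof -
    have "r \<cdot> (i \<cdot> a) = z W D" using a r by (simp add: Hom_iff)
    moreover have "r \<cdot> (i \<cdot> a) = a" using i r a(1) by (simp add: Hom_iff reassoc[OF ri])
    ultimately show ?thesis by simp
  qed
  then have m: "mono_arr C i" using mono_iff[OF i] by blast
  have "a = z X W" if a: "a \<in> Hom C X W" "a \<cdot> p = z E W" for W a
  proof -
    have "(a \<cdot> p) \<cdot> s = z X W" using a s by (simp add: Hom_iff)
    moreover have "(a \<cdot> p) \<cdot> s = a" using p s a(1) by (simp add: Hom_iff ps)
    ultimately show ?thesis by simp
  qed
  then have e: "epi_arr C p" using epi_iff[OF p] by blast
  have "(g \<cdot> s) \<cdot> p = g" if g: "g \<in> Hom C E W" "g \<cdot> i = z D W" for W g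
  proof (rule biproduct_coeqI[OF B _ g(1)])
    show "(g \<cdot> s) \<cdot> p \<in> Hom C E W" using g s p by blast
    show "((g \<cdot> s) \<cdot> p) \<cdot> s = g \<cdot> s" using g(1) s p by (simp add: Hom_iff ps)
    show "((g \<cdot> s) \<cdot> p) \<cdot> i = g \<cdot> i" using g s p i by (simp add: Hom_iff pi)
  qed
  then have c: "is_cokernel C p i" using is_cokernel_iff[OF p i] e pi s by blast
  then show ?thesis using mono_kernel_of_cokernel[OF m i c p] by (simp add: short_exact_def)
qed

text \<open>The complementary idempotent \<open>d\<close>, that is 1 minus
  \<open>i \<cdot> r\<close>, kills \<open>i\<close>; its factorization through the cokernel
  \<open>p\<close> is the section \<open>s\<close>.\<close>

lemma short_exact_split:
  assumes ex: "short_exact C i p" and i: "i \<in> Hom C D E" and p: "p \<in> Hom C E X"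
    and r: "r \<in> Hom C E D" and ri: "r \<cdot> i = Ident C D"
  obtains s where "biproduct X D E p r s i"
proof -
  have "is_cokernel C p i" using ex by (simp add: short_exact_def)
  note c = cokernel_facts[OF this p i]
  have E: "E \<in> Obj C" using i hom_obj by blast
  have ir: "i \<cdot> r \<in> Hom C E E" using i r by blast
  obtain d where d: "d \<in> Hom C E E" "d = z E E \<longleftrightarrow> Ident C E = i \<cdot> r" "d \<oplus> i \<cdot> r = Ident C E"
    "\<And>W a. a \<in> Hom C W E \<Longrightarrow> d \<cdot> a = z W E \<longleftrightarrow> Ident C E \<cdot> a = (i \<cdot> r) \<cdot> a"
    "\<And>W a. a \<in> Hom C E W \<Longrightarrow> a \<cdot> d = z E W \<longleftrightarrow> a \<cdot> Ident C E = a \<cdot> (i \<cdot> r)"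
    by (rule difference[OF ident_hom[OF E] ir]) blast
  have "d \<cdot> i = z D E" using d(4)[OF i] i r by (simp add: Hom_iff ri)
  then obtain s where s: "s \<in> Hom C X E" "s \<cdot> p = d" using c(3) d(1) by blast
  have "r \<cdot> d = z E D" using d(5)[OF r] i r by (simp add: Hom_iff reassoc[OF ri])
  then have "(r \<cdot> s) \<cdot> p = z E D" using r s p by (simp add: Hom_iff)
  then have rs: "r \<cdot> s = z X D" using epi_zero[OF c(1) p] r s by blast
  have "p \<cdot> d \<oplus> p \<cdot> (i \<cdot> r) = p" using comp_add[OF p d(1) ir, symmetric] d(3) hom_ident(1)[OF p] by simp
  moreover have "p \<cdot> (i \<cdot> r) = z E X" using p i r by (simp add: Hom_iff reassoc[OF c(2)])
  ultimately have "p \<cdot> d = p" using add_zero[OF hom_comp[OF p d(1)]] by simp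
  then have "(p \<cdot> s) \<cdot> p = Ident C X \<cdot> p" using p s by (simp add: Hom_iff)
  then have ps: "p \<cdot> s = Ident C X" using epi_cancel[OF c(1) p] p s ident_hom hom_obj by blast
  show ?thesis
    by (rule that[of s]) (use p r s i d(3) c(2) rs ps ri in \<open>simp add: biproduct_def\<close>)
qed

lemma extensions_iff:
  "(i, p) \<in> extensions C X D \<longleftrightarrow> (\<exists>E. i \<in> Hom C D E \<and> p \<in> Hom C E X \<and> short_exact C i p)"
proof
  assume "(i, p) \<in> extensions C X D"
  then have e: "short_exact C i p" "Dom C i = D" "Cod C p = X" by (simp_all add: extensions_def)
  then have "i \<in> Arr C" "p \<in> Arr C" "Cod C i = Dom C p"
    unfolding short_exact_def is_kernel_def by blast+
  then have "i \<in> Hom C D (Dom C p)" "p \<in> Hom C (Dom C p) X" using e by (simp_all add: Hom_def)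
  then show "\<exists>E. i \<in> Hom C D E \<and> p \<in> Hom C E X \<and> short_exact C i p" using e(1) by blast
next
  assume "\<exists>E. i \<in> Hom C D E \<and> p \<in> Hom C E X \<and> short_exact C i p"
  then show "(i, p) \<in> extensions C X D" unfolding extensions_def Hom_def by blast
qed

text \<open>Both middle objects are biproducts of \<open>X\<close> and \<open>D\<close>. The
  comparison arrows match the two projections, so that mutual inverseness and compatibility with the
  inclusions can be checked on projections.\<close>

lemma extensions_split_equiv:
  assumes ip: "(i, p) \<in> Ext1_zero C X D" and jq: "(j, q) \<in> Ext1_zero C X D"
  shows "((i, p), (j, q)) \<in> ext_equiv C X D"
proof -
  obtain E where i: "i \<in> Hom C D E" and p: "p \<in> Hom C E X" and ex: "short_exact C i p"
    using ip extensions_iff by (auto simp: Ext1_zero_def)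
  obtain r where r: "r \<in> Hom C E D" and ri: "r \<cdot> i = Ident C D"
    using ip hom_cod[OF i] by (auto simp: Ext1_zero_def)
  obtain E' where j: "j \<in> Hom C D E'" and q: "q \<in> Hom C E' X" and ex': "short_exact C j q"
    using jq extensions_iff by (auto simp: Ext1_zero_def)
  obtain t where t: "t \<in> Hom C E' D" and tj: "t \<cdot> j = Ident C D"
    using jq hom_cod[OF j] by (auto simp: Ext1_zero_def)
  obtain s where B: "biproduct X D E p r s i" using short_exact_split[OF ex i p r ri] .
  obtain s' where B': "biproduct X D E' q t s' j" using short_exact_split[OF ex' j q t tj] .
  obtain \<phi> where f: "\<phi> \<in> Hom C E E'" "q \<cdot> \<phi> = p" "t \<cdot> \<phi> = r" using biproduct_pair[OF B' p r] .
  obtain \<psi> where g: "\<psi> \<in> Hom C E' E" "p \<cdot> \<psi> = q" "r \<cdot> \<psi> = t" using biproduct_pair[OF B q t] .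
  have o: "E \<in> Obj C" "E' \<in> Obj C" using i j hom_obj by auto
  have "\<psi> \<cdot> \<phi> = Ident C E"
    by (rule biproduct_eqI[OF B hom_comp[OF g(1) f(1)] ident_hom[OF o(1)]];
        use f g(1) p r in \<open>simp add: Hom_iff reassoc[OF g(2)] reassoc[OF g(3)]\<close>)
  moreover have "\<phi> \<cdot> \<psi> = Ident C E'"
    by (rule biproduct_eqI[OF B' hom_comp[OF f(1) g(1)] ident_hom[OF o(2)]];
        use f(1) g q t in \<open>simp add: Hom_iff reassoc[OF f(2)] reassoc[OF f(3)]\<close>)
  ultimately have "iso_arr C \<phi>" using f g by (auto simp: iso_arr_def Hom_def)
  moreover have "\<phi> \<cdot> i = j"
    by (rule biproduct_eqI[OF B' hom_comp[OF f(1) i] j];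
        use f(1) i q t B B' in \<open>simp add: Hom_iff reassoc[OF f(2)] reassoc[OF f(3)] biproduct_def\<close>)
  ultimately show ?thesis
    using ip jq f hom_cod[OF i] hom_cod[OF j] by (auto simp: ext_equiv_def Ext1_zero_def)
qed

text \<open>From left to right, each extension belongs to its own class by reflexivity. Conversely,
  split extensions form a single class, and the biproduct supplies a member, without which the set
  of classes would be empty rather than a singleton.\<close>

lemma Ext1_trivial_iff:
  assumes X: "X \<in> Obj C" and D: "D \<in> Obj C"
  shows "Ext1 C X D = {Ext1_zero C X D} \<longleftrightarrow> extensions C X D \<subseteq> Ext1_zero C X D"
proof
  have refl: "(x, x) \<in> ext_equiv C X D" if x: "x \<in> extensions C X D" for x
  proof -
    obtain i p where ip: "x = (i, p)" by force
    obtain E where i: "i \<in> Hom C D E" and p: "p \<in> Hom C E X"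
      using x ip extensions_iff by auto
    have E: "E \<in> Obj C" by (rule hom_obj(2)[OF i])
    have "iso_arr C (Ident C E)" unfolding iso_arr_def using E by (intro conjI bexI[of _ "Ident C E"]) simp_all
    then have "\<exists>\<phi>\<in>Hom C (Cod C i) (Cod C i). iso_arr C \<phi> \<and> \<phi> \<cdot> i = i \<and> p \<cdot> \<phi> = p"
      using E i p hom_ident hom_cod[OF i] by (intro bexI[of _ "Ident C E"]) auto
    then show ?thesis using x ip by (simp add: ext_equiv_def)
  qed
  {
    assume E: "Ext1 C X D = {Ext1_zero C X D}"
    show "extensions C X D \<subseteq> Ext1_zero C X D"
    proof
      fix x assume x: "x \<in> extensions C X D"
      then have "ext_equiv C X D `` {x} \<in> Ext1 C X D" by (simp add: Ext1_def quotientI)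
      then show "x \<in> Ext1_zero C X D" using E refl[OF x] by auto
    qed
  }
  assume sub: "extensions C X D \<subseteq> Ext1_zero C X D"
  have "ext_equiv C X D `` {x} = Ext1_zero C X D" if x: "x \<in> extensions C X D" for x
  proof -
    have "ext_equiv C X D `` {x} \<subseteq> extensions C X D" by (auto simp: ext_equiv_def)
    moreover have "(x, y) \<in> ext_equiv C X D" if "y \<in> Ext1_zero C X D" for y
      using extensions_split_equiv sub x that by (cases x; cases y) blast
    ultimately show ?thesis using sub by blast
  qed
  moreover obtain x where "x \<in> extensions C X D"
  proof -
    obtain E p r s i where B: "biproduct X D E p r s i" using ex_biproduct[OF X D] .
    have "i \<in> Hom C D E" "p \<in> Hom C E X" using B by (simp_all add: biproduct_def)
    then show ?thesis using that extensions_iff short_exact_biproduct[OF B] by blast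
  qed
  ultimately show "Ext1 C X D = {Ext1_zero C X D}"
    unfolding Ext1_def quotient_def by blast
qed

text \<open>\<open>E\<close> is the pushout of \<open>m\<close> and \<open>f\<close>: the cokernel
  of the difference \<open>j\<close> of \<open>i1 \<cdot> m\<close> and \<open>i2 \<cdot> f\<close>
  into the biproduct of \<open>N\<close> and \<open>D\<close>. As \<open>p1 \<cdot> j = m\<close>,
  monicity of \<open>m\<close> passes to \<open>j\<close>, so \<open>j\<close> is the kernel of that
  cokernel.\<close>

lemma pushout_extension:
  assumes m: "m \<in> Hom C M N" "mono_arr C m" and q: "q \<in> Hom C N Q" "is_cokernel C q m"
    and f: "f \<in> Hom C M D"
  obtains E i p c where "i \<in> Hom C D E" "p \<in> Hom C E Q" "short_exact C i p" "c \<in> Hom C N E"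
    "c \<cdot> m = i \<cdot> f"
proof -
  note q' = cokernel_facts[OF q(2,1) m(1)]
  obtain P p1 p2 i1 i2 where B: "biproduct N D P p1 p2 i1 i2"
    using ex_biproduct[OF hom_obj(2)[OF m(1)] hom_obj(2)[OF f]] .
  have p1: "p1 \<in> Hom C P N" and p2: "p2 \<in> Hom C P D" and i1: "i1 \<in> Hom C N P" and i2: "i2 \<in> Hom C D P"
    and p1i1: "p1 \<cdot> i1 = Ident C N" and p2i2: "p2 \<cdot> i2 = Ident C D" and p1i2: "p1 \<cdot> i2 = z D N"
    using B unfolding biproduct_def by blast+
  have if2: "i2 \<cdot> f \<in> Hom C M P" using i2 f by blast
  obtain j where j: "j \<in> Hom C M P" "j = z M P \<longleftrightarrow> i1 \<cdot> m = i2 \<cdot> f" "j \<oplus> i2 \<cdot> f = i1 \<cdot> m"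
    "\<And>W a. a \<in> Hom C W M \<Longrightarrow> j \<cdot> a = z W P \<longleftrightarrow> (i1 \<cdot> m) \<cdot> a = (i2 \<cdot> f) \<cdot> a"
    "\<And>W a. a \<in> Hom C P W \<Longrightarrow> a \<cdot> j = z M W \<longleftrightarrow> a \<cdot> (i1 \<cdot> m) = a \<cdot> (i2 \<cdot> f)"
    by (rule difference[OF hom_comp[OF i1 m(1)] if2]) blast
  have "p1 \<cdot> j \<oplus> p1 \<cdot> (i2 \<cdot> f) = p1 \<cdot> (i1 \<cdot> m)" using comp_add[OF p1 j(1) if2, symmetric] j(3) by simp
  moreover have "p1 \<cdot> (i2 \<cdot> f) = z M N" using p1 i2 f by (simp add: Hom_iff reassoc[OF p1i2])
  moreover have "p1 \<cdot> (i1 \<cdot> m) = m" using p1 i1 m by (simp add: Hom_iff reassoc[OF p1i1])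
  ultimately have p1j: "p1 \<cdot> j = m" using add_zero[OF hom_comp[OF p1 j(1)]] by simp
  have "a = z W M" if a: "a \<in> Hom C W M" "j \<cdot> a = z W P" for W a
  proof -
    have "m \<cdot> a = p1 \<cdot> (j \<cdot> a)" using p1 j(1) a(1) by (simp add: Hom_iff reassoc[OF p1j])
    also have "\<dots> = z W N" using a p1 by (simp add: Hom_iff)
    finally show ?thesis using mono_zero[OF m(2,1) a(1)] by blast
  qed
  then have jm: "mono_arr C j" using mono_iff[OF j(1)] by blast
  obtain E c0 where c0: "c0 \<in> Hom C P E" "is_cokernel C c0 j" using ex_cokernel[OF j(1)] .
  note c0' = cokernel_facts[OF c0(2,1) j(1)]
  note kj = kernel_facts[OF mono_kernel_of_cokernel[OF jm j(1) c0(2,1)] j(1) c0(1)]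
  define c where "c = c0 \<cdot> i1"
  define i where "i = c0 \<cdot> i2"
  have c: "c \<in> Hom C N E" and i: "i \<in> Hom C D E" using c0 i1 i2 by (auto simp: c_def i_def)
  have cm: "c \<cdot> m = i \<cdot> f"
    using j(5)[OF c0(1)] c0'(2) c0(1) i1 i2 m f by (simp add: c_def i_def Hom_iff)
  have "a = z W D" if a: "a \<in> Hom C W D" "i \<cdot> a = z W E" for W a
  proof -
    \<comment> \<open>\<open>i2 \<cdot> a\<close> comes from some \<open>b\<close> through
      \<open>j\<close>. Its \<open>N\<close>-component is both zero and \<open>m \<cdot> b\<close>,
      so \<open>b\<close> vanishes, and with it \<open>a\<close>.\<close>
    have "c0 \<cdot> (i2 \<cdot> a) = z W E" using a c0 i2 by (simp add: i_def Hom_iff)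
    then obtain b where b: "b \<in> Hom C W M" "j \<cdot> b = i2 \<cdot> a" using kj(3) i2 a by blast
    have "m \<cdot> b = p1 \<cdot> (j \<cdot> b)" using p1 j(1) b(1) by (simp add: Hom_iff reassoc[OF p1j])
    also have "\<dots> = z W N" unfolding b(2) using p1 i2 a(1) by (simp add: Hom_iff reassoc[OF p1i2])
    finally have "b = z W M" using mono_zero[OF m(2,1) b(1)] by blast
    then have 0: "i2 \<cdot> a = z W P" using b j(1) by (auto simp: Hom_iff)
    have "a = p2 \<cdot> (i2 \<cdot> a)" using p2 i2 a(1) by (simp add: Hom_iff reassoc[OF p2i2])
    then show ?thesis unfolding 0 using p2 a(1) by (simp add: Hom_iff)
  qed
  then have im: "mono_arr C i" using mono_iff[OF i] by blast
  \<comment> \<open>On the biproduct the map to \<open>Q\<close> is \<open>q\<close> on the summand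
    \<open>N\<close> and zero on \<open>D\<close>; it descends to the pushout because it kills
    \<open>j\<close>.\<close>
  have "(q \<cdot> p1) \<cdot> j = z M Q" using q p1 j(1) q'(2) by (simp add: Hom_iff p1j)
  then obtain p where p: "p \<in> Hom C E Q" "p \<cdot> c0 = q \<cdot> p1" using c0'(3) q p1 by blast
  have pi: "p \<cdot> i = z D Q" using p(1) c0 i2 q p1 by (simp add: i_def Hom_iff reassoc[OF p(2)] p1i2)
  have pc: "p \<cdot> c = q" using p(1) c0 i1 q p1 by (simp add: c_def Hom_iff reassoc[OF p(2)] p1i1)
  have "b = z Q W" if b: "b \<in> Hom C Q W" "b \<cdot> p = z E W" for W b
  proof -
    have "b \<cdot> q = z N W" using b(1) p(1) c by (simp add: Hom_iff reassoc[OF b(2)] flip: pc)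
    then show ?thesis using epi_zero[OF q'(1) q(1)] b by blast
  qed
  then have pe: "epi_arr C p" using epi_iff[OF p(1)] by blast
  have "\<exists>u\<in>Hom C Q W. u \<cdot> p = g" if g: "g \<in> Hom C E W" "g \<cdot> i = z D W" for W g
  proof -
    \<comment> \<open>The factor through \<open>p\<close> is found on \<open>N\<close>: there
      \<open>g\<close> kills \<open>m\<close> and factors through \<open>q\<close>. Agreement on all
      of \<open>E\<close> is then checked on the two summands.\<close>
    have "(g \<cdot> c) \<cdot> m = z M W" using g(1) c m i f by (simp add: Hom_iff cm reassoc[OF g(2)])
    then obtain u where u: "u \<in> Hom C Q W" "u \<cdot> q = g \<cdot> c" using q'(3) g c by blast
    have "(u \<cdot> p) \<cdot> c0 = g \<cdot> c0"
    proof (rule biproduct_coeqI[OF B])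
      show "(u \<cdot> p) \<cdot> c0 \<in> Hom C P W" "g \<cdot> c0 \<in> Hom C P W" using u p c0 g by auto
      have "((u \<cdot> p) \<cdot> c0) \<cdot> i1 = u \<cdot> (p \<cdot> c)" using u(1) p(1) c0(1) i1 by (simp add: Hom_iff c_def)
      also have "\<dots> = (g \<cdot> c0) \<cdot> i1" unfolding pc u(2) using g(1) c0(1) i1 by (simp add: Hom_iff c_def)
      finally show "((u \<cdot> p) \<cdot> c0) \<cdot> i1 = (g \<cdot> c0) \<cdot> i1" .
      have "((u \<cdot> p) \<cdot> c0) \<cdot> i2 = u \<cdot> (p \<cdot> i)" using u(1) p(1) c0(1) i2 by (simp add: Hom_iff i_def)
      also have "\<dots> = (g \<cdot> c0) \<cdot> i2"
        unfolding pi using g(1) c0(1) i2 u(1) g(2)[unfolded i_def] by (simp add: Hom_iff)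
      finally show "((u \<cdot> p) \<cdot> c0) \<cdot> i2 = (g \<cdot> c0) \<cdot> i2" .
    qed
    then have "u \<cdot> p = g" using epi_cancel[OF c0'(1) c0(1)] u p g by blast
    then show ?thesis using u by blast
  qed
  then have pk: "is_cokernel C p i" using is_cokernel_iff[OF p(1) i] pe pi by blast
  then have "short_exact C i p"
    using mono_kernel_of_cokernel[OF im i pk p(1)] by (simp add: short_exact_def)
  then show ?thesis using that i p(1) c cm by blast
qed

end


section \<open>Torsion theories\<close>

locale torsion_cat = abelian_cat +
  fixes \<gamma> :: "('a, 'b, 'a, 'b) functr" and \<iota> :: "'a \<Rightarrow> 'b"
  assumes left_exact_radical: "left_exact_radical C \<gamma> \<iota>"
begin

abbreviation "T \<equiv> torsion C \<iota>"
text \<open>Inside the locales \<open>F\<close> stands for the torsion-free class; the canonical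
  functor is called \<open>quot\<close>.\<close>

abbreviation "F \<equiv> torsion_free C \<gamma>"

section \<open>Closure properties of the torsion and torsion-free classes\<close>

lemma preradical: "preradical C \<gamma> \<iota>"
  using left_exact_radical by (simp add: left_exact_radical_def radical_def)

lemma incl_hom: "X \<in> Obj C \<Longrightarrow> \<iota> X \<in> Hom C (FObj \<gamma> X) X"
  and incl_mono: "X \<in> Obj C \<Longrightarrow> mono_arr C (\<iota> X)"
  using preradical by (simp_all add: preradical_def nat_trans_def id_functor_def)

lemma radical_hom: "f \<in> Hom C X Y \<Longrightarrow> FArr \<gamma> f \<in> Hom C (FObj \<gamma> X) (FObj \<gamma> Y)"
  using preradical by (auto simp: preradical_def is_functor_def Hom_def)

lemma incl_natural: "f \<in> Hom C X Y \<Longrightarrow> \<iota> Y \<cdot> FArr \<gamma> f = f \<cdot> \<iota> X"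
  using preradical by (auto simp: preradical_def nat_trans_def id_functor_def Hom_def)

lemma radical_kernel: "is_kernel C k f \<Longrightarrow> is_kernel C (FArr \<gamma> k) (FArr \<gamma> f)"
  using left_exact_radical by (simp add: left_exact_radical_def left_exact_def)

lemma torsion_obj: "X \<in> T \<Longrightarrow> X \<in> Obj C"
  and torsion_free_obj: "X \<in> F \<Longrightarrow> X \<in> Obj C"
  by (simp_all add: torsion_def torsion_free_def)

lemma incl_retraction:
  assumes "X \<in> T"
  obtains j where "j \<in> Hom C X (FObj \<gamma> X)" "\<iota> X \<cdot> j = Ident C X"
  using assms hom_dom[OF incl_hom] hom_cod[OF incl_hom] unfolding torsion_def iso_arr_def by auto

lemma torsionI_section:
  "\<lbrakk>X \<in> Obj C; u \<in> Hom C X (FObj \<gamma> X); \<iota> X \<cdot> u = Ident C X\<rbrakk> \<Longrightarrow> X \<in> T"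
  unfolding torsion_def using iso_of_mono_section[OF incl_mono incl_hom] by blast

text \<open>By left exactness \<open>FArr \<gamma> m\<close> is the kernel of
  \<open>FArr \<gamma> g\<close>, where \<open>g\<close> is the cokernel of \<open>m\<close>. With
  \<open>j\<close> inverse to \<open>\<iota> X\<close>, naturality shows that
  \<open>FArr \<gamma> g\<close> kills \<open>j \<cdot> m\<close>; the resulting factor through
  \<open>FArr \<gamma> m\<close> is a section of \<open>\<iota> K\<close>.\<close>

lemma torsion_subobject:
  assumes X: "X \<in> T" and m: "mono_arr C m" "m \<in> Hom C K X"
  shows "K \<in> T"
proof -
  have K: "K \<in> Obj C" using hom_obj m by blast
  obtain Q g where g: "g \<in> Hom C X Q" "is_cokernel C g m" using ex_cokernel[OF m(2)] .
  note g' = cokernel_facts[OF g(2,1) m(2)]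
  have "is_kernel C m g" using mono_kernel_of_cokernel[OF m g(2,1)] .
  note ker = kernel_facts[OF radical_kernel[OF this] radical_hom[OF m(2)] radical_hom[OF g(1)]]
  obtain j where j: "j \<in> Hom C X (FObj \<gamma> X)" "\<iota> X \<cdot> j = Ident C X" using incl_retraction[OF X] .
  have o: "Q \<in> Obj C" "X \<in> Obj C" using g hom_obj by auto
  note i = incl_hom[OF o(1)] incl_hom[OF o(2)] incl_hom[OF K]
  note r = radical_hom[OF g(1)] radical_hom[OF m(2)]
  have "\<iota> Q \<cdot> (FArr \<gamma> g \<cdot> (j \<cdot> m)) = z K Q"
    using i r g(1) m(2) j(1) g'(2) by (simp add: Hom_iff reassoc[OF incl_natural[OF g(1)]] reassoc[OF j(2)])
  then have "FArr \<gamma> g \<cdot> (j \<cdot> m) = z K (FObj \<gamma> Q)"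
    using mono_zero[OF incl_mono[OF o(1)] i(1)] r(1) j(1) m(2) by blast
  then obtain u where u: "u \<in> Hom C K (FObj \<gamma> K)" "FArr \<gamma> m \<cdot> u = j \<cdot> m" using ker(3) j m by blast
  have "m \<cdot> (\<iota> K \<cdot> u) = \<iota> X \<cdot> (FArr \<gamma> m \<cdot> u)"
    using i r m(2) u(1) by (simp add: Hom_iff reassoc[OF incl_natural[OF m(2)]])
  also have "\<dots> = m \<cdot> Ident C K" unfolding u(2) using i j(1) m(2) by (simp add: Hom_iff reassoc[OF j(2)])
  finally have "\<iota> K \<cdot> u = Ident C K"
    using mono_cancel[OF m hom_comp[OF i(3) u(1)] ident_hom[OF K]] by blast
  then show ?thesis using torsionI_section K u by blast
qed

text \<open>Since \<open>\<iota> X\<close> is invertible, naturality makes \<open>a\<close> factor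
  through \<gamma>(Y), which is zero.\<close>

lemma torsion_torsion_free_zero:
  assumes X: "X \<in> T" and Y: "Y \<in> F" and a: "a \<in> Hom C X Y"
  shows "a = z X Y"
proof -
  obtain j where j: "j \<in> Hom C X (FObj \<gamma> X)" "\<iota> X \<cdot> j = Ident C X" using incl_retraction[OF X] .
  note o = torsion_obj[OF X] torsion_free_obj[OF Y]
  note i = incl_hom[OF o(1)] incl_hom[OF o(2)]
  have Z: "zero_obj C (FObj \<gamma> Y)" using Y by (simp add: torsion_free_def)
  have 0: "FArr \<gamma> a \<cdot> j = z X (FObj \<gamma> Y)"
    using zero_obj_hom_unique(1)[OF Z hom_comp[OF radical_hom[OF a] j(1)]] zero_hom hom_obj i by blast
  have "a = (a \<cdot> \<iota> X) \<cdot> j" using a i j by (simp add: Hom_iff)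
  also have "\<dots> = \<iota> Y \<cdot> (FArr \<gamma> a \<cdot> j)"
    using i a j(1) radical_hom[OF a] by (simp add: Hom_iff flip: incl_natural[OF a])
  also have "\<dots> = z X Y" unfolding 0 using i o by (simp add: Hom_iff)
  finally show ?thesis .
qed

text \<open>Idempotence of \<gamma>, from left exactness: \<open>\<iota> X\<close> is the kernel of
  its cokernel \<open>g\<close>, and \<open>FArr \<gamma> g\<close> vanishes, so
  \<open>FArr \<gamma> (\<iota> X)\<close> is a kernel of zero and has a section. Naturality and
  monicity of \<open>\<iota> X\<close> identify it with the inclusion of
  \<gamma>(\<gamma>(X)).\<close>

lemma radical_torsion:
  assumes X: "X \<in> Obj C"
  shows "FObj \<gamma> X \<in> T"
proof -
  note i = incl_hom[OF X] and m = incl_mono[OF X]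
  obtain Q g where g: "g \<in> Hom C X Q" "is_cokernel C g (\<iota> X)" using ex_cokernel[OF i] .
  note g' = cokernel_facts[OF g(2,1) i]
  have "is_kernel C (\<iota> X) g" using mono_kernel_of_cokernel[OF m i g(2,1)] .
  note ker = kernel_facts[OF radical_kernel[OF this] radical_hom[OF i] radical_hom[OF g(1)]]
  have Q: "Q \<in> Obj C" "FObj \<gamma> X \<in> Obj C" using g i hom_obj by auto
  have "\<iota> Q \<cdot> FArr \<gamma> g = z (FObj \<gamma> X) Q" unfolding incl_natural[OF g(1)] by (rule g')
  then have "FArr \<gamma> g = z (FObj \<gamma> X) (FObj \<gamma> Q)"
    using mono_zero[OF incl_mono incl_hom radical_hom] Q(1) g(1) by blast
  then have "FArr \<gamma> g \<cdot> Ident C (FObj \<gamma> X) = z (FObj \<gamma> X) (FObj \<gamma> Q)"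
    using radical_hom[OF g(1)] by (simp add: Hom_iff)
  then obtain u where u: "u \<in> Hom C (FObj \<gamma> X) (FObj \<gamma> (FObj \<gamma> X))" "FArr \<gamma> (\<iota> X) \<cdot> u = Ident C (FObj \<gamma> X)"
    using ker(3) ident_hom[OF Q(2)] by blast
  have "FArr \<gamma> (\<iota> X) = \<iota> (FObj \<gamma> X)"
    using mono_cancel[OF m i radical_hom[OF i] incl_hom[OF Q(2)] incl_natural[OF i]] .
  then show ?thesis using torsionI_section Q(2) u by simp
qed

text \<open>The decisive test arrow is \<open>\<iota> Y\<close> itself, whose domain is torsion by
  idempotence; being monic and zero, it has zero domain.\<close>

lemma torsion_freeI:
  assumes Y: "Y \<in> Obj C" and *: "\<And>X a. X \<in> T \<Longrightarrow> a \<in> Hom C X Y \<Longrightarrow> a = z X Y"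
  shows "Y \<in> F"
proof -
  have i: "\<iota> Y \<in> Hom C (FObj \<gamma> Y) Y" using incl_hom[OF Y] .
  then have o: "FObj \<gamma> Y \<in> Obj C" using hom_obj by blast
  have "\<iota> Y \<cdot> Ident C (FObj \<gamma> Y) = z (FObj \<gamma> Y) Y"
    using *[OF radical_torsion[OF Y] i] hom_ident(1)[OF i] by simp
  then have "Ident C (FObj \<gamma> Y) = z (FObj \<gamma> Y) (FObj \<gamma> Y)"
    using mono_zero[OF incl_mono[OF Y] i ident_hom[OF o]] by blast
  then show ?thesis using Y zero_objI[OF o] by (simp add: torsion_free_def)
qed

text \<open>Here the radical condition enters: X/\<gamma>(X) is torsion-free, so the projection onto
  it vanishes and its kernel \<open>\<iota> X\<close> has a section.\<close>

lemma torsionI: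
  assumes X: "X \<in> Obj C" and *: "\<And>Y a. Y \<in> F \<Longrightarrow> a \<in> Hom C X Y \<Longrightarrow> a = z X Y"
  shows "X \<in> T"
proof -
  note i = incl_hom[OF X] and m = incl_mono[OF X]
  obtain Q q where q: "q \<in> Hom C X Q" "is_cokernel C q (\<iota> X)" using ex_cokernel[OF i] .
  have "zero_obj C (FObj \<gamma> (Cod C q))"
    using left_exact_radical X q(2) by (simp add: left_exact_radical_def radical_def)
  then have "Q \<in> F" using q hom_obj[OF q(1)] by (simp add: torsion_free_def hom_cod)
  then have "q = z X Q" using * q by blast
  then have "q \<cdot> Ident C X = z X Q" using hom_ident(1)[OF q(1)] by simp
  moreover note kernel_facts(3)[OF mono_kernel_of_cokernel[OF m i q(2,1)] i q(1)]
  ultimately obtain u where "u \<in> Hom C X (FObj \<gamma> X)" "\<iota> X \<cdot> u = Ident C X" using X ident_hom by blast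
  then show ?thesis using torsionI_section X by blast
qed

section \<open>Dense arrows and the calculus of right fractions\<close>

definition dense :: "'b \<Rightarrow> bool" where
  "dense e \<longleftrightarrow> (\<forall>W\<in>F. \<forall>b\<in>Hom C (Cod C e) W. b \<cdot> e = z (Dom C e) W \<longrightarrow> b = z (Cod C e) W)"

lemma dense_iff:
  "e \<in> Hom C X Y \<Longrightarrow> dense e \<longleftrightarrow> (\<forall>W\<in>F. \<forall>b\<in>Hom C Y W. b \<cdot> e = z X W \<longrightarrow> b = z Y W)"
  by (simp add: dense_def Hom_def)

lemma dense_zero:
  "\<lbrakk>dense e; e \<in> Hom C X Y; W \<in> F; b \<in> Hom C Y W; b \<cdot> e = z X W\<rbrakk> \<Longrightarrow> b = z Y W"
  using dense_iff by blast

text \<open>Arrows out of the cokernel are the arrows out of \<open>Y\<close> that kill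
  \<open>e\<close>. Density says that none of them into a torsion-free object is nonzero, which
  characterizes torsion of \<open>Q\<close>.\<close>

lemma dense_iff_cokernel_torsion:
  assumes e: "e \<in> Hom C X Y" and c: "is_cokernel C c e" "c \<in> Hom C Y Q"
  shows "dense e \<longleftrightarrow> Q \<in> T"
proof
  note c' = cokernel_facts[OF c e]
  {
    assume d: "dense e"
    show "Q \<in> T"
    proof (rule torsionI)
      show "Q \<in> Obj C" using c hom_obj by blast
      fix W a assume W: "W \<in> F" and a: "a \<in> Hom C Q W"
      have "(a \<cdot> c) \<cdot> e = z X W" using a c(2) e c'(2) by (simp add: Hom_iff)
      then have "a \<cdot> c = z Y W" using dense_zero[OF d e W] a c by blast
      then show "a = z Q W" using epi_zero[OF c'(1) c(2) a] by blast
    qed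
  }
  assume Q: "Q \<in> T"
  have "b = z Y W" if W: "W \<in> F" and b: "b \<in> Hom C Y W" "b \<cdot> e = z X W" for W b
  proof -
    obtain u where u: "u \<in> Hom C Q W" "u \<cdot> c = b" using c'(3) b by blast
    then have "u = z Q W" using torsion_torsion_free_zero Q W by blast
    then show ?thesis using u c(2) by (auto simp: Hom_iff)
  qed
  then show "dense e" using dense_iff[OF e] by blast
qed

lemma dense_comp:
  assumes "dense e" "e \<in> Hom C X Y" "dense f" "f \<in> Hom C W X"
  shows "dense (e \<cdot> f)"
proof -
  have "b = z Y V" if V: "V \<in> F" and b: "b \<in> Hom C Y V" "b \<cdot> (e \<cdot> f) = z W V" for V b
  proof -
    have "(b \<cdot> e) \<cdot> f = z W V" using b assms by (simp add: Hom_iff)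
    then show ?thesis using dense_zero[OF assms(3,4) V] dense_zero[OF assms(1,2) V] b assms by blast
  qed
  then show ?thesis using dense_iff[OF hom_comp[OF assms(2,4)]] by blast
qed

lemma dense_of_comp:
  assumes "dense (e \<cdot> f)" "e \<in> Hom C X Y" "f \<in> Hom C W X"
  shows "dense e"
proof -
  have "b = z Y V" if V: "V \<in> F" and b: "b \<in> Hom C Y V" "b \<cdot> e = z X V" for V b
  proof -
    have "b \<cdot> (e \<cdot> f) = z W V" using b(1) assms(2,3) by (simp add: Hom_iff reassoc[OF b(2)])
    then show ?thesis using dense_zero[OF assms(1) hom_comp[OF assms(2,3)] V] b assms by blast
  qed
  then show ?thesis using dense_iff[OF assms(2)] by blast
qed

lemma epi_dense: "epi_arr C e \<Longrightarrow> e \<in> Hom C X Y \<Longrightarrow> dense e"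
  using dense_iff epi_zero by blast

text \<open>Makes torsion objects a special case of dense arrows, so that the square lemmas for
  dense arrows apply to them.\<close>

lemma dense_zero_arr_iff:
  assumes "X \<in> Obj C" "Y \<in> Obj C"
  shows "dense (z X Y) \<longleftrightarrow> Y \<in> T"
proof -
  have *: "b \<cdot> z X Y = z X W" if "b \<in> Hom C Y W" for b W using assms that by (simp add: Hom_iff)
  show ?thesis
    using dense_iff[OF zero_hom[OF assms]] * torsionI[OF assms(2)] torsion_torsion_free_zero
    by blast
qed

text \<open>\<open>k\<close> is the preimage of the subobject \<open>m\<close> along
  \<open>x\<close>, obtained as the kernel of \<open>c \<cdot> x\<close>. Its cokernel embeds into
  the torsion object \<open>Q\<close>, so heredity of torsion makes \<open>k\<close> dense.\<close>

lemma dense_mono_square: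
  assumes m: "m \<in> Hom C Y V" "mono_arr C m" "dense m" and x: "x \<in> Hom C W V"
  obtains P k y where "k \<in> Hom C P W" "y \<in> Hom C P Y" "dense k" "x \<cdot> k = m \<cdot> y"
proof -
  obtain Q c where c: "c \<in> Hom C V Q" "is_cokernel C c m" using ex_cokernel[OF m(1)] .
  have Q: "Q \<in> T" using dense_iff_cokernel_torsion[OF m(1) c(2,1)] m(3) by blast
  have cx: "c \<cdot> x \<in> Hom C W Q" using c x by blast
  obtain P k where k: "k \<in> Hom C P W" "is_kernel C k (c \<cdot> x)" using ex_kernel[OF cx] .
  note k' = kernel_facts[OF k(2,1) cx]
  obtain I q where q: "q \<in> Hom C W I" "is_cokernel C q k" using ex_cokernel[OF k(1)] .
  obtain n where n: "n \<in> Hom C I Q" "mono_arr C n"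
    using ex_mono_epi_factorization[OF cx k(2,1) q(2,1)] by metis
  have "I \<in> T" using torsion_subobject[OF Q n(2,1)] .
  then have d: "dense k" using dense_iff_cokernel_torsion[OF k(1) q(2,1)] by blast
  have "c \<cdot> (x \<cdot> k) = z P Q" using k'(2) k(1) x c(1) by (simp add: Hom_iff)
  then obtain y where "y \<in> Hom C P Y" "m \<cdot> y = x \<cdot> k"
    using kernel_facts(3)[OF mono_kernel_of_cokernel[OF m(2,1) c(2,1)] m(1) c(1)] x k by blast
  then show ?thesis using that k(1) d by metis
qed

text \<open>\<open>e\<close> factors as an epimorphism \<open>q\<close> followed by a monomorphism
  \<open>m\<close>, and \<open>m\<close> inherits density. The square for \<open>m\<close> is
  completed by pulling back along \<open>q\<close>, which costs only a further epimorphism.\<close>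

lemma dense_square:
  assumes e: "e \<in> Hom C Y V" "dense e" and x: "x \<in> Hom C W V"
  obtains P k y where "k \<in> Hom C P W" "y \<in> Hom C P Y" "dense k" "x \<cdot> k = e \<cdot> y"
proof -
  obtain K l where l: "l \<in> Hom C K Y" "is_kernel C l e" using ex_kernel[OF e(1)] .
  obtain I q where q: "q \<in> Hom C Y I" "is_cokernel C q l" using ex_cokernel[OF l(1)] .
  obtain m where m: "m \<in> Hom C I V" "mono_arr C m" "m \<cdot> q = e"
    using ex_mono_epi_factorization[OF e(1) l(2,1) q(2,1)] by metis
  have "dense m" using dense_of_comp[OF _ m(1) q(1)] m(3) e(2) by simp
  then obtain R k y where k: "k \<in> Hom C R W" "y \<in> Hom C R I" "dense k" and sq: "x \<cdot> k = m \<cdot> y"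
    using dense_mono_square[OF m(1,2) _ x] by metis
  obtain P a b where a: "a \<in> Hom C P Y" and b: "b \<in> Hom C P R" and ab: "q \<cdot> a = y \<cdot> b"
    and "epi_arr C q \<Longrightarrow> epi_arr C b"
    using pullback[OF q(1) k(2)] by metis
  then have "dense b" using epi_dense cokernel_facts(1)[OF q(2,1) l(1)] by blast
  then have "dense (k \<cdot> b)" using dense_comp k b by blast
  moreover have "x \<cdot> (k \<cdot> b) = e \<cdot> a"
    using x k(1,2) a b m(1) q(1) by (simp add: Hom_iff reassoc[OF sq] ab flip: m(3))
  ultimately show ?thesis using that[of "k \<cdot> b" P a] k a b by blast
qed

text \<open>Replaces the condition on the kernel object by one on arrows: everything that
  \<open>s\<close> kills is already zero after a dense arrow. Later arguments can then proceed
  without naming kernels.\<close>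

lemma quot_iso_iff:
  assumes s: "s \<in> Hom C X Y"
  shows "quot_iso C T s \<longleftrightarrow> dense s \<and>
    (\<forall>W. \<forall>a\<in>Hom C W X. s \<cdot> a = z W Y \<longrightarrow> (\<exists>V. \<exists>e\<in>Hom C V W. dense e \<and> a \<cdot> e = z V X))"
    (is "_ \<longleftrightarrow> dense s \<and> ?M")
proof
  assume q: "quot_iso C T s"
  obtain c where c: "is_cokernel C c s" "Cod C c \<in> T" using q by (auto simp: quot_iso_def)
  have ch: "c \<in> Hom C Y (Cod C c)" using c(1) s by (auto simp: is_cokernel_def Hom_def)
  obtain k where k: "is_kernel C k s" "Dom C k \<in> T" using q by (auto simp: quot_iso_def)
  have kh: "k \<in> Hom C (Dom C k) X" using k(1) s by (auto simp: is_kernel_def Hom_def)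
  let ?K = "Dom C k"
  have K: "?K \<in> Obj C" using kh hom_obj by blast
  have "\<exists>V. \<exists>e\<in>Hom C V W. dense e \<and> a \<cdot> e = z V X" if a: "a \<in> Hom C W X" "s \<cdot> a = z W Y" for W a
  proof -
    obtain u where u: "u \<in> Hom C W ?K" "k \<cdot> u = a" using kernel_facts(3)[OF k(1) kh s] a by blast
    \<comment> \<open>The kernel is torsion, so its zero endomorphism is dense; completing the
      square of \<open>u\<close> against it makes \<open>u\<close> vanish after the dense
      \<open>e\<close>.\<close>
    obtain V e y where e: "e \<in> Hom C V W" "y \<in> Hom C V ?K" "dense e" "u \<cdot> e = z ?K ?K \<cdot> y"
      using dense_square[OF zero_hom[OF K K] _ u(1)] dense_zero_arr_iff[OF K K] k(2) by metis
    have "a \<cdot> e = k \<cdot> (u \<cdot> e)" using u e(1) kh by (auto simp: Hom_iff)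
    also have "\<dots> = z V X" unfolding e(4) using e(2) kh K by (simp add: Hom_iff)
    finally show ?thesis using e by blast
  qed
  then show "dense s \<and> ?M" using dense_iff_cokernel_torsion[OF s c(1) ch] c(2) by blast
next
  assume *: "dense s \<and> ?M"
  obtain Q c where c: "c \<in> Hom C Y Q" "is_cokernel C c s" using ex_cokernel[OF s] .
  obtain K k where k: "k \<in> Hom C K X" "is_kernel C k s" using ex_kernel[OF s] .
  note k' = kernel_facts[OF k(2,1) s]
  have "Q \<in> T" using dense_iff_cokernel_torsion[OF s c(2,1)] * by blast
  moreover have "K \<in> T"
  proof -
    \<comment> \<open>Applied to the kernel arrow itself: monicity turns
      \<open>k \<cdot> e = 0\<close> into \<open>e = 0\<close>, and a dense zero arrow has torsion
      target.\<close>
    obtain V e where e: "e \<in> Hom C V K" "dense e" "k \<cdot> e = z V X" using * k(1) k'(2) by blast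
    then have "e = z V K" using mono_zero[OF k'(1) k(1)] by blast
    then show ?thesis using dense_zero_arr_iff e hom_obj by blast
  qed
  ultimately show "quot_iso C T s"
    using s c k unfolding quot_iso_def Hom_def by blast
qed

lemma quot_iso_dense: "quot_iso C T s \<Longrightarrow> s \<in> Hom C X Y \<Longrightarrow> dense s"
  using quot_iso_iff by blast

lemma quot_iso_zero:
  assumes "quot_iso C T s" "s \<in> Hom C X Y" "a \<in> Hom C W X" "s \<cdot> a = z W Y"
  obtains V e where "e \<in> Hom C V W" "dense e" "a \<cdot> e = z V X"
  using quot_iso_iff[OF assms(2)] assms by blast

lemma dense_ident:
  assumes X: "X \<in> Obj C"
  shows "dense (Ident C X)"
proof -
  have "b = z X W" if "b \<in> Hom C X W" "b \<cdot> Ident C X = z X W" for W b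
    using that hom_ident(1)[OF that(1)] by simp
  then show ?thesis unfolding dense_iff[OF ident_hom[OF X]] by blast
qed

lemma dense_mono_quot_iso:
  assumes m: "mono_arr C m" "m \<in> Hom C X Y" "dense m"
  shows "quot_iso C T m"
proof -
  have "\<exists>V. \<exists>e\<in>Hom C V W. dense e \<and> a \<cdot> e = z V X" if a: "a \<in> Hom C W X" "m \<cdot> a = z W Y" for W a
  proof -
    have W: "W \<in> Obj C" "X \<in> Obj C" using a hom_obj by auto
    have "a = z W X" using mono_zero[OF m(1,2)] a by blast
    then have "a \<cdot> Ident C W = z W X" using W by simp
    then show ?thesis using W dense_ident ident_hom by blast
  qed
  then show ?thesis using quot_iso_iff[OF m(2)] m(3) by blast
qed

lemma quot_iso_ident:
  assumes X: "X \<in> Obj C"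
  shows "quot_iso C T (Ident C X)"
proof (rule dense_mono_quot_iso[OF _ ident_hom[OF X] dense_ident[OF X]])
  have "a = z W X" if "a \<in> Hom C W X" "Ident C X \<cdot> a = z W X" for W a
    using that hom_ident(2)[OF that(1)] by simp
  then show "mono_arr C (Ident C X)" unfolding mono_iff[OF ident_hom[OF X]] by blast
qed

lemma quot_iso_comp:
  assumes s: "quot_iso C T s" "s \<in> Hom C Y V" and t: "quot_iso C T t" "t \<in> Hom C X Y"
  shows "quot_iso C T (s \<cdot> t)"
proof -
  have "\<exists>U. \<exists>e\<in>Hom C U W. dense e \<and> a \<cdot> e = z U X" if a: "a \<in> Hom C W X" "(s \<cdot> t) \<cdot> a = z W V" for W a
  proof -
    have "s \<cdot> (t \<cdot> a) = z W V" using a s t by (simp add: Hom_iff)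
    then obtain U e where e: "e \<in> Hom C U W" "dense e" "(t \<cdot> a) \<cdot> e = z U Y"
      using quot_iso_zero[OF s hom_comp[OF t(2) a(1)]] by blast
    then have "t \<cdot> (a \<cdot> e) = z U Y" using a t by (simp add: Hom_iff)
    then obtain U' e' where e': "e' \<in> Hom C U' U" "dense e'" "(a \<cdot> e) \<cdot> e' = z U' X"
      using quot_iso_zero[OF t hom_comp[OF a(1) e(1)]] by blast
    then have "a \<cdot> (e \<cdot> e') = z U' X" using a e by (simp add: Hom_iff)
    then show ?thesis using dense_comp e e' by blast
  qed
  moreover have "dense (s \<cdot> t)" using dense_comp quot_iso_dense s t by blast
  ultimately show ?thesis using quot_iso_iff[OF hom_comp[OF s(2) t(2)]] by blast
qed

text \<open>The pullback serves. The dense arrow of \<open>dense_square\<close> factors through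
  \<open>p\<close>, so \<open>p\<close> is dense. If \<open>p\<close> kills \<open>a\<close>, then
  \<open>s\<close> kills \<open>q \<cdot> a\<close>, which vanishes after a dense arrow, and joint
  monicity transfers this to \<open>a\<close>.\<close>

lemma quot_iso_ore:
  assumes s: "quot_iso C T s" "s \<in> Hom C Y V" and x: "x \<in> Hom C W V"
  obtains P p q where "p \<in> Hom C P W" "q \<in> Hom C P Y" "quot_iso C T p" "x \<cdot> p = s \<cdot> q"
proof -
  obtain P p q where p: "p \<in> Hom C P W" and q: "q \<in> Hom C P Y" and sq: "x \<cdot> p = s \<cdot> q"
    and jm: "\<And>U a. \<lbrakk>a \<in> Hom C U P; p \<cdot> a = z U W; q \<cdot> a = z U Y\<rbrakk> \<Longrightarrow> a = z U P"
    and un: "\<And>U a b. \<lbrakk>a \<in> Hom C U W; b \<in> Hom C U Y; x \<cdot> a = s \<cdot> b\<rbrakk>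
      \<Longrightarrow> \<exists>u\<in>Hom C U P. p \<cdot> u = a \<and> q \<cdot> u = b"
    using pullback[OF x s(2)] by metis
  obtain R k y where k: "k \<in> Hom C R W" "y \<in> Hom C R Y" "dense k" "x \<cdot> k = s \<cdot> y"
    using dense_square[OF s(2) quot_iso_dense[OF s] x] .
  then obtain u where "u \<in> Hom C R P" "p \<cdot> u = k" using un by blast
  then have "dense p" using dense_of_comp k(3) p by blast
  moreover have "\<exists>V. \<exists>e\<in>Hom C V U. dense e \<and> a \<cdot> e = z V P" if a: "a \<in> Hom C U P" "p \<cdot> a = z U W" for U a
  proof -
    have "x \<cdot> (p \<cdot> a) = z U V" unfolding a(2) using x a(1) by (simp add: Hom_iff)
    then have "s \<cdot> (q \<cdot> a) = z U V" using x p q s(2) a(1) by (simp add: Hom_iff reassoc[OF sq])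
    then obtain R e where e: "e \<in> Hom C R U" "dense e" "(q \<cdot> a) \<cdot> e = z R Y"
      using quot_iso_zero[OF s hom_comp[OF q a(1)]] by blast
    have "p \<cdot> (a \<cdot> e) = z R W" using p a(1) e(1) by (simp add: Hom_iff reassoc[OF a(2)])
    moreover have "q \<cdot> (a \<cdot> e) = z R Y" using q a(1) e by (simp add: Hom_iff)
    ultimately show ?thesis using jm a e by blast
  qed
  ultimately have "quot_iso C T p" using quot_iso_iff[OF p] by blast
  then show ?thesis using that p q sq by blast
qed

lemma quot_iso_equalize:
  assumes s: "quot_iso C T s" "s \<in> Hom C X Y" and a: "a \<in> Hom C W X" and b: "b \<in> Hom C W X"
    and eq: "s \<cdot> a = s \<cdot> b"
  obtains V r where "r \<in> Hom C V W" "quot_iso C T r" "a \<cdot> r = b \<cdot> r"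
proof -
  obtain d where d: "d \<in> Hom C W X"
    "\<And>V r. r \<in> Hom C V W \<Longrightarrow> d \<cdot> r = z V X \<longleftrightarrow> a \<cdot> r = b \<cdot> r" "s \<cdot> d = z W Y \<longleftrightarrow> s \<cdot> a = s \<cdot> b"
    using difference[OF a b] s(2) by metis
  obtain U e where e: "e \<in> Hom C U W" "dense e" "d \<cdot> e = z U X"
    using quot_iso_zero[OF s d(1)] d(3) eq by blast
  \<comment> \<open>\<open>e\<close> is only known to be dense. The kernel of the difference is
    dense too, because \<open>e\<close> factors through it, and as a dense monomorphism it is
    inverted in the quotient.\<close>
  obtain V k where k: "k \<in> Hom C V W" "is_kernel C k d" using ex_kernel[OF d(1)] .
  note k' = kernel_facts[OF k(2,1) d(1)]
  obtain u where "u \<in> Hom C U V" "k \<cdot> u = e" using k'(3) e by blast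
  then have "quot_iso C T k" using dense_mono_quot_iso[OF k'(1) k(1)] dense_of_comp k(1) e(2) by blast
  then show ?thesis using that k(1) k'(2) d(2) by blast
qed

text \<open>The kernel condition is inherited from \<open>s \<cdot> u\<close>. For density, a dense
  \<open>k\<close> satisfies \<open>s \<cdot> k = (s \<cdot> u) \<cdot> y\<close>; cancelling
  \<open>s\<close> after an inverted \<open>r\<close> makes the dense arrow
  \<open>k \<cdot> r\<close> factor through \<open>u\<close>.\<close>

lemma quot_iso_cancel:
  assumes s: "quot_iso C T s" "s \<in> Hom C Y V" and u: "u \<in> Hom C X Y" and su: "quot_iso C T (s \<cdot> u)"
  shows "quot_iso C T u"
proof -
  have suh: "s \<cdot> u \<in> Hom C X V" using s u by blast
  have "\<exists>U. \<exists>e\<in>Hom C U W. dense e \<and> a \<cdot> e = z U X" if a: "a \<in> Hom C W X" "u \<cdot> a = z W Y" for W a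
  proof -
    have "(s \<cdot> u) \<cdot> a = z W V" using s u a by (simp add: Hom_iff)
    then show ?thesis using quot_iso_zero[OF su suh a(1)] by blast
  qed
  moreover have "dense u"
  proof -
    obtain P k y where k: "k \<in> Hom C P Y" "y \<in> Hom C P X" "dense k" "s \<cdot> k = (s \<cdot> u) \<cdot> y"
      using dense_square[OF suh quot_iso_dense[OF su suh] s(2)] .
    then have "s \<cdot> k = s \<cdot> (u \<cdot> y)" using s u by (simp add: Hom_iff)
    then obtain R r where r: "r \<in> Hom C R P" "quot_iso C T r" "k \<cdot> r = (u \<cdot> y) \<cdot> r"
      using quot_iso_equalize[OF s k(1) hom_comp[OF u k(2)]] by blast
    then have "dense (k \<cdot> r)" using dense_comp k quot_iso_dense by blast
    moreover have "k \<cdot> r = u \<cdot> (y \<cdot> r)" using r u k by (simp add: Hom_iff)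
    ultimately show ?thesis using dense_of_comp[OF _ u hom_comp[OF k(2) r(1)]] by simp
  qed
  ultimately show ?thesis using quot_iso_iff[OF u] by blast
qed

end


section \<open>The quotient category and its section functor\<close>

context torsion_cat
begin

abbreviation "K \<equiv> quot_cat C T"

section \<open>Roofs and their classes\<close>

lemma quot_cat_obj [simp]: "Obj K = Obj C"
  by (simp add: quot_cat_def)

lemma roof_iff:
  "roof C T (s, f) \<longleftrightarrow> (\<exists>X M N. s \<in> Hom C X M \<and> f \<in> Hom C X N \<and> quot_iso C T s)"
proof
  assume r: "roof C T (s, f)"
  then have "s \<in> Arr C" "f \<in> Arr C" "Dom C f = Dom C s" "quot_iso C T s"
    by (simp_all add: roof_def quot_iso_def)
  then have "s \<in> Hom C (Dom C s) (Cod C s)" "f \<in> Hom C (Dom C s) (Cod C f)" "quot_iso C T s"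
    by (simp_all add: Hom_def)
  then show "\<exists>X M N. s \<in> Hom C X M \<and> f \<in> Hom C X N \<and> quot_iso C T s" by blast
next
  assume "\<exists>X M N. s \<in> Hom C X M \<and> f \<in> Hom C X N \<and> quot_iso C T s"
  then obtain X M N where "s \<in> Hom C X M" "f \<in> Hom C X N" "quot_iso C T s" by blast
  then show "roof C T (s, f)" by (simp add: roof_def Hom_def)
qed

lemma roof_equivI:
  assumes "s \<in> Hom C X M" "f \<in> Hom C X N" "quot_iso C T s"
    "s' \<in> Hom C X' M" "f' \<in> Hom C X' N" "quot_iso C T s'"
    "u \<in> Hom C W X" "u' \<in> Hom C W X'" "s \<cdot> u = s' \<cdot> u'" "quot_iso C T (s \<cdot> u)" "f \<cdot> u = f' \<cdot> u'"
  shows "roof_equiv C T (s, f) (s', f')"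
proof -
  have "roof C T (s, f)" "roof C T (s', f')" using assms roof_iff by blast+
  moreover have "u \<in> Arr C" "u' \<in> Arr C" "Dom C u = Dom C u'" "Cod C u = Dom C s"
    "Cod C u' = Dom C s'" "Cod C s = Cod C s'" "Cod C f = Cod C f'"
    using assms by (simp_all add: Hom_def)
  ultimately show ?thesis unfolding roof_equiv_def using assms(9-11) by blast
qed

lemma roof_equivE:
  assumes e: "roof_equiv C T (s, f) (s', f')" and s: "s \<in> Hom C X M" and f: "f \<in> Hom C X N"
  obtains X' W u u' where "quot_iso C T s" "s' \<in> Hom C X' M" "f' \<in> Hom C X' N" "quot_iso C T s'"
    "u \<in> Hom C W X" "u' \<in> Hom C W X'" "s \<cdot> u = s' \<cdot> u'" "quot_iso C T (s \<cdot> u)" "f \<cdot> u = f' \<cdot> u'"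
proof -
  have r: "roof C T (s, f)" "roof C T (s', f')" "Cod C s = Cod C s'" "Cod C f = Cod C f'"
    using e unfolding roof_equiv_def by auto
  obtain u u' where u: "u \<in> Arr C" "u' \<in> Arr C" "Dom C u = Dom C u'" "Cod C u = Dom C s"
    "Cod C u' = Dom C s'" "s \<cdot> u = s' \<cdot> u'" "quot_iso C T (s \<cdot> u)" "f \<cdot> u = f' \<cdot> u'"
    using e unfolding roof_equiv_def by auto
  have q: "quot_iso C T s" "quot_iso C T s'" using r unfolding roof_def by auto
  have s': "s' \<in> Hom C (Dom C s') M" "f' \<in> Hom C (Dom C s') N"
    using r s f unfolding roof_def quot_iso_def Hom_def by auto
  have u': "u \<in> Hom C (Dom C u) X" "u' \<in> Hom C (Dom C u) (Dom C s')"
    using u(1-5) s unfolding Hom_def by auto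
  show ?thesis by (rule that[OF q(1) s' q(2) u' u(6-8)])
qed

lemma roof_equiv_refl:
  assumes "s \<in> Hom C X M" "f \<in> Hom C X N" "quot_iso C T s"
  shows "roof_equiv C T (s, f) (s, f)"
proof -
  have X: "X \<in> Obj C" using assms hom_obj by blast
  show ?thesis
    by (rule roof_equivI[OF assms assms ident_hom[OF X] ident_hom[OF X]])
      (use assms in \<open>simp_all add: hom_ident\<close>)
qed

lemma roof_equiv_sym: "roof_equiv C T x y \<Longrightarrow> roof_equiv C T y x"
proof -
  assume "roof_equiv C T x y"
  moreover obtain s f s' f' where xy: "x = (s, f)" "y = (s', f')" by force
  ultimately have e: "roof_equiv C T (s, f) (s', f')" by simp
  then obtain X M N where s: "s \<in> Hom C X M" "f \<in> Hom C X N"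
    using roof_iff unfolding roof_equiv_def by blast
  obtain X' W u u' where q: "quot_iso C T s" and s': "s' \<in> Hom C X' M" "f' \<in> Hom C X' N" "quot_iso C T s'"
    and u: "u \<in> Hom C W X" "u' \<in> Hom C W X'" "s \<cdot> u = s' \<cdot> u'" "quot_iso C T (s \<cdot> u)" "f \<cdot> u = f' \<cdot> u'"
    using roof_equivE[OF e s] .
  have "quot_iso C T (s' \<cdot> u')" using u(3,4) by simp
  then show ?thesis
    unfolding xy using roof_equivI[OF s' s q u(2,1) u(3)[symmetric] _ u(5)[symmetric]] by blast
qed

text \<open>The two refinements meet over the middle roof in an Ore square of \<open>v\<close> and
  \<open>u'\<close>. This square exists because \<open>u'\<close> is itself inverted, by cancelling
  \<open>s'\<close> from \<open>s' \<cdot> u'\<close>.\<close>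

lemma roof_equiv_trans:
  assumes xy: "roof_equiv C T (s, f) (s', f')" and yz: "roof_equiv C T (s', f') (s'', f'')"
  shows "roof_equiv C T (s, f) (s'', f'')"
proof -
  obtain X M N where s: "s \<in> Hom C X M" "f \<in> Hom C X N"
    using xy roof_iff unfolding roof_equiv_def by blast
  obtain X' W u u' where s': "s' \<in> Hom C X' M" "f' \<in> Hom C X' N" and q: "quot_iso C T s" "quot_iso C T s'"
    and u: "u \<in> Hom C W X" "u' \<in> Hom C W X'" "s \<cdot> u = s' \<cdot> u'" "quot_iso C T (s \<cdot> u)" "f \<cdot> u = f' \<cdot> u'"
    using roof_equivE[OF xy s] by metis
  obtain X'' V v v' where s'': "s'' \<in> Hom C X'' M" "f'' \<in> Hom C X'' N" and q'': "quot_iso C T s''"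
    and v: "v \<in> Hom C V X'" "v' \<in> Hom C V X''" "s' \<cdot> v = s'' \<cdot> v'" "quot_iso C T (s' \<cdot> v)" "f' \<cdot> v = f'' \<cdot> v'"
    using roof_equivE[OF yz s'] by metis
  have "quot_iso C T u'" using quot_iso_cancel[OF q(2) s'(1) u(2)] u(3,4) by simp
  then obtain P p r where p: "p \<in> Hom C P V" "r \<in> Hom C P W" "quot_iso C T p" "v \<cdot> p = u' \<cdot> r"
    using quot_iso_ore[OF _ u(2) v(1)] by blast
  show ?thesis
  proof (rule roof_equivI[OF s q(1) s'' q'' hom_comp[OF u(1) p(2)] hom_comp[OF v(2) p(1)]])
    have "s \<cdot> (u \<cdot> r) = s' \<cdot> (u' \<cdot> r)" "f \<cdot> (u \<cdot> r) = f' \<cdot> (u' \<cdot> r)"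
      using s s' u(1,2) p(2) by (simp_all add: Hom_iff reassoc[OF u(3)] reassoc[OF u(5)])
    then have su: "s \<cdot> (u \<cdot> r) = s' \<cdot> (v \<cdot> p)" and fu: "f \<cdot> (u \<cdot> r) = f' \<cdot> (v \<cdot> p)"
      by (simp_all add: p(4))
    have "s' \<cdot> (v \<cdot> p) = s'' \<cdot> (v' \<cdot> p)" "f' \<cdot> (v \<cdot> p) = f'' \<cdot> (v' \<cdot> p)"
      using s' s'' v(1,2) p(1) by (simp_all add: Hom_iff reassoc[OF v(3)] reassoc[OF v(5)])
    then show "s \<cdot> (u \<cdot> r) = s'' \<cdot> (v' \<cdot> p)" "f \<cdot> (u \<cdot> r) = f'' \<cdot> (v' \<cdot> p)" using su fu by simp_all
    have "quot_iso C T ((s' \<cdot> v) \<cdot> p)"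
      using quot_iso_comp[OF v(4) hom_comp[OF s'(1) v(1)] p(3,1)] .
    then show "quot_iso C T (s \<cdot> (u \<cdot> r))"
      unfolding su hom_assoc[OF s'(1) v(1) p(1)] .
  qed
qed

lemma roof_class_mem: "y \<in> roof_class C T x \<longleftrightarrow> roof_equiv C T x y"
  by (simp add: roof_class_def)

lemma roof_class_eqI: "roof_equiv C T x y \<Longrightarrow> roof_class C T x = roof_class C T y"
proof -
  assume xy: "roof_equiv C T x y"
  have tr: "roof_equiv C T a c" if "roof_equiv C T a b" "roof_equiv C T b c" for a b c
    using that by (cases a, cases b, cases c) (metis roof_equiv_trans)
  show ?thesis
    unfolding roof_class_def using tr[OF xy] tr[OF roof_equiv_sym[OF xy]] by blast
qed

text \<open>\<open>Dom\<close> and \<open>Cod\<close> of the quotient are definite descriptions over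
  a class; they are determined because equivalent roofs share both ends.\<close>

lemma roof_class_hom:
  assumes s: "s \<in> Hom C X M" and f: "f \<in> Hom C X N" and q: "quot_iso C T s"
  shows "roof_class C T (s, f) \<in> Hom K M N"
proof -
  let ?c = "roof_class C T (s, f)"
  have self: "(s, f) \<in> ?c" using roof_class_mem roof_equiv_refl[OF assms] by blast
  have mem: "Cod C s' = M \<and> Cod C f' = N" if "(s', f') \<in> ?c" for s' f'
    using that hom_cod[OF s] hom_cod[OF f] unfolding roof_class_mem roof_equiv_def by auto
  have "?c \<in> Arr K" using roof_iff assms unfolding quot_cat_def by auto
  moreover have "Dom K ?c = M" unfolding quot_cat_def cat.simps
  proof (rule the_equality)
    show "\<exists>(s', f')\<in>?c. M = Cod C s'" using self hom_cod[OF s] by blast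
  qed (use mem in blast)
  moreover have "Cod K ?c = N" unfolding quot_cat_def cat.simps
  proof (rule the_equality)
    show "\<exists>(s', f')\<in>?c. N = Cod C f'" using self hom_cod[OF f] by blast
  qed (use mem in blast)
  ultimately show ?thesis by (simp add: Hom_def)
qed

lemma quot_hom_roof:
  assumes "\<phi> \<in> Hom K M N"
  obtains X s f where "s \<in> Hom C X M" "f \<in> Hom C X N" "quot_iso C T s" "\<phi> = roof_class C T (s, f)"
proof -
  have "\<phi> \<in> Arr K" using assms by (simp add: Hom_def)
  then obtain s f where r: "roof C T (s, f)" and \<phi>: "\<phi> = roof_class C T (s, f)"
    unfolding quot_cat_def by auto
  then obtain X M' N' where s: "s \<in> Hom C X M'" "f \<in> Hom C X N'" "quot_iso C T s"
    using roof_iff by blast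
  then have "\<phi> \<in> Hom K M' N'" using roof_class_hom \<phi> by blast
  then have "M' = M" "N' = N" using assms by (auto simp: Hom_def)
  then show ?thesis using that s \<phi> by blast
qed

abbreviation "quot \<equiv> quot_functor C T"

lemma quot_functor_obj [simp]: "FObj quot X = X"
  by (simp add: quot_functor_def)

lemma quot_functor_arr: "f \<in> Hom C X Y \<Longrightarrow> FArr quot f = roof_class C T (Ident C X, f)"
  by (simp add: quot_functor_def Hom_def)

lemma quot_functor_hom: "f \<in> Hom C X Y \<Longrightarrow> FArr quot f \<in> Hom K X Y"
  using roof_class_hom[OF ident_hom _ quot_iso_ident] hom_obj(1) by (simp add: quot_functor_arr)

text \<open>The arrow \<open>u\<close>, used for both legs, is the common refinement of the two
  roofs.\<close>

lemma quot_functor_eqI: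
  assumes a: "a \<in> Hom C X Y" and b: "b \<in> Hom C X Y" and u: "u \<in> Hom C W X" "quot_iso C T u"
    and eq: "a \<cdot> u = b \<cdot> u"
  shows "FArr quot a = FArr quot b"
proof -
  have X: "X \<in> Obj C" using a hom_obj by blast
  have "roof_equiv C T (Ident C X, a) (Ident C X, b)"
    by (rule roof_equivI[OF ident_hom[OF X] a quot_iso_ident[OF X] ident_hom[OF X] b quot_iso_ident[OF X] u(1) u(1)])
      (simp_all add: hom_ident(2)[OF u(1)] u eq)
  then show ?thesis using roof_class_eqI quot_functor_arr a b by simp
qed

lemma quot_comp:
  "\<psi> \<cdot>\<^bsub>K\<^esub> \<phi> = \<Union> {roof_class C T (s \<cdot> w, g \<cdot> v) | s f t g w v.
        (s, f) \<in> \<phi> \<and> (t, g) \<in> \<psi> \<and> quot_iso C T w \<and> v \<in> Arr C \<and> Dom C w = Dom C v \<and>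
        Cod C w = Dom C f \<and> Cod C v = Dom C t \<and> f \<cdot> w = t \<cdot> v}"
  by (simp add: quot_cat_def)

text \<open>Every arrow of the quotient is of the form \<open>g s\<inverse>\<close>.  This is the only composite in the
  quotient that has to be computed.\<close>

lemma roof_class_comp_denominator:
  assumes s: "s \<in> Hom C X M" and g: "g \<in> Hom C X N" and q: "quot_iso C T s"
  shows "roof_class C T (s, g) \<cdot>\<^bsub>K\<^esub> FArr quot s = FArr quot g"
proof -
  have X: "X \<in> Obj C" using s hom_obj by blast
  note qX = quot_iso_ident[OF X] and hX = ident_hom[OF X]
  \<comment> \<open>\<open>Comp\<close> is a union, so every admissible choice of representatives
    and square must contribute the same class, and at least one choice must exist.\<close>
  have "roof_class C T (s0 \<cdot> w, g' \<cdot> v) = FArr quot g"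
    if m: "(s0, f0) \<in> roof_class C T (Ident C X, s)" and n: "(t, g') \<in> roof_class C T (s, g)"
      and w: "quot_iso C T w" and v: "v \<in> Arr C" and dwv: "Dom C w = Dom C v"
      and cw: "Cod C w = Dom C f0" and cv: "Cod C v = Dom C t" and sq: "f0 \<cdot> w = t \<cdot> v"
    for s0 f0 t g' w v
  proof -
    obtain A U u u' where s0: "s0 \<in> Hom C A X" "f0 \<in> Hom C A M" "quot_iso C T s0"
      and u: "u \<in> Hom C U X" "u' \<in> Hom C U A" "Ident C X \<cdot> u = s0 \<cdot> u'" "quot_iso C T (Ident C X \<cdot> u)" "s \<cdot> u = f0 \<cdot> u'"
      using roof_equivE[OF m[unfolded roof_class_mem] hX s] by metis
    have uu: "u = s0 \<cdot> u'" using u(1,3) hom_ident(2) by simp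
    obtain B Y y y' where t: "t \<in> Hom C B M" "g' \<in> Hom C B N" "quot_iso C T t"
      and y: "y \<in> Hom C Y X" "y' \<in> Hom C Y B" "s \<cdot> y = t \<cdot> y'" "quot_iso C T (s \<cdot> y)" "g \<cdot> y = g' \<cdot> y'"
      using roof_equivE[OF n[unfolded roof_class_mem] s g] by metis
    obtain P where w': "w \<in> Hom C P A" and v': "v \<in> Hom C P B"
      using v dwv cw cv hom_dom[OF s0(2)] hom_dom[OF t(1)] w unfolding quot_iso_def Hom_def by auto
    \<comment> \<open>The given square is compared with the refinements behind both memberships:
      \<open>w\<close> is made to pass through \<open>u'\<close> and then \<open>v\<close> through
      \<open>y'\<close>, each after an inverted arrow.\<close>
    have "quot_iso C T u'" using quot_iso_cancel[OF s0(3,1) u(2)] u(3,4) by simp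
    then obtain R1 r1 c1 where r1: "r1 \<in> Hom C R1 P" "c1 \<in> Hom C R1 U" "quot_iso C T r1" "w \<cdot> r1 = u' \<cdot> c1"
      using quot_iso_ore[OF _ u(2) w'] by blast
    have "quot_iso C T y'" using quot_iso_cancel[OF t(3,1) y(2)] y(3,4) by simp
    then obtain R2 r2 c2 where r2: "r2 \<in> Hom C R2 R1" "c2 \<in> Hom C R2 Y" "quot_iso C T r2" "(v \<cdot> r1) \<cdot> r2 = y' \<cdot> c2"
      using quot_iso_ore[OF _ y(2) hom_comp[OF v' r1(1)]] by blast
    have vr: "v \<cdot> (r1 \<cdot> r2) = y' \<cdot> c2" using r2 v' r1 by (simp add: Hom_iff)
    have ur: "u \<cdot> c1 = s0 \<cdot> (w \<cdot> r1)" using s0(1) u(2) r1(2) by (simp add: Hom_iff uu r1(4))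
    \<comment> \<open>The refinements yield two arrows into \<open>X\<close>, one from each
      membership. They agree after \<open>s\<close>, and since \<open>s\<close> is inverted they
      agree after a further inverted \<open>r3\<close>.\<close>
    have "s \<cdot> (u \<cdot> (c1 \<cdot> r2)) = f0 \<cdot> (u' \<cdot> (c1 \<cdot> r2))"
      using s u(1,2) s0(2) r1(2) r2(1) by (simp add: Hom_iff reassoc[OF u(5)])
    also have "\<dots> = f0 \<cdot> (w \<cdot> (r1 \<cdot> r2))"
      using w' u(2) s0(2) r1(1,2) r2(1) by (simp add: Hom_iff reassoc[OF r1(4)])
    also have "\<dots> = t \<cdot> (y' \<cdot> c2)"
      using w' v' s0(2) t(1) r1(1) r2(1) by (simp add: Hom_iff reassoc[OF sq] vr)
    also have "\<dots> = s \<cdot> (y \<cdot> c2)"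
      using s t(1) y(1,2) r2(2) by (simp add: Hom_iff reassoc[OF y(3)])
    finally obtain R3 r3 where r3: "r3 \<in> Hom C R3 R2" "quot_iso C T r3"
        and eq: "(u \<cdot> (c1 \<cdot> r2)) \<cdot> r3 = (y \<cdot> c2) \<cdot> r3"
      using quot_iso_equalize[OF q s hom_comp[OF u(1) hom_comp[OF r1(2) r2(1)]] hom_comp[OF y(1) r2(2)]]
      by metis
    define r where "r = r1 \<cdot> (r2 \<cdot> r3)"
    have r: "r \<in> Hom C R3 P" using r1 r2 r3 by (auto simp: r_def)
    define r' where "r' = (y \<cdot> c2) \<cdot> r3"
    have r': "r' \<in> Hom C R3 X" using y r2 r3 by (auto simp: r'_def)
    have s0w: "s0 \<cdot> w \<in> Hom C P X" using s0 w' by blast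
    have "(s0 \<cdot> w) \<cdot> r = (u \<cdot> c1) \<cdot> (r2 \<cdot> r3)"
      unfolding ur using s0(1) w' r1(1) r2(1) r3(1) by (simp add: r_def Hom_iff)
    also have "\<dots> = r'"
      unfolding r'_def eq[symmetric] using u(1) r1(2) r2(1) r3(1) by (simp add: Hom_iff)
    finally have e1: "(s0 \<cdot> w) \<cdot> r = r'" .
    have "(g' \<cdot> v) \<cdot> r = (g' \<cdot> (v \<cdot> (r1 \<cdot> r2))) \<cdot> r3"
      using t(2) v' r1(1) r2(1) r3(1) by (simp add: r_def Hom_iff)
    also have "\<dots> = ((g \<cdot> y) \<cdot> c2) \<cdot> r3"
      unfolding vr y(5) using t(2) y(2) r2(2) r3(1) by (simp add: Hom_iff)
    also have "\<dots> = g \<cdot> r'" using g y(1) r2(2) r3(1) by (simp add: r'_def Hom_iff)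
    finally have e2: "(g' \<cdot> v) \<cdot> r = g \<cdot> r'" .
    have qw: "quot_iso C T (s0 \<cdot> w)" using quot_iso_comp[OF s0(3,1) w w'] .
    have "quot_iso C T r"
      unfolding r_def using quot_iso_comp[OF r1(3,1) quot_iso_comp[OF r2(3,1) r3(2,1)]] r2(1) r3(1) by blast
    then have qr: "quot_iso C T ((s0 \<cdot> w) \<cdot> r)" using quot_iso_comp[OF qw s0w _ r] by blast
    have "roof_equiv C T (s0 \<cdot> w, g' \<cdot> v) (Ident C X, g)"
      by (rule roof_equivI[OF s0w hom_comp[OF t(2) v'] qw hX g qX r r'])
        (use e1 e2 qr hom_ident(2)[OF r'] in simp_all)
    then show ?thesis using roof_class_eqI quot_functor_arr[OF g] by simp
  qed
  \<comment> \<open>The union is nonempty: the original roofs with identities for \<open>w\<close>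
    and \<open>v\<close> form a square.\<close>
  moreover have "\<exists>s0 f0 t g' w v. FArr quot g = roof_class C T (s0 \<cdot> w, g' \<cdot> v) \<and>
        (s0, f0) \<in> roof_class C T (Ident C X, s) \<and> (t, g') \<in> roof_class C T (s, g) \<and>
        quot_iso C T w \<and> v \<in> Arr C \<and> Dom C w = Dom C v \<and>
        Cod C w = Dom C f0 \<and> Cod C v = Dom C t \<and> f0 \<cdot> w = t \<cdot> v"
  proof (intro exI conjI)
    show "FArr quot g = roof_class C T (Ident C X \<cdot> Ident C X, g \<cdot> Ident C X)"
      using X hom_ident(1)[OF g] by (simp add: quot_functor_arr[OF g])
    show "(Ident C X, s) \<in> roof_class C T (Ident C X, s)"
      unfolding roof_class_mem by (rule roof_equiv_refl[OF hX s qX])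
    show "(s, g) \<in> roof_class C T (s, g)"
      unfolding roof_class_mem by (rule roof_equiv_refl[OF s g q])
  qed (use X qX s in \<open>simp_all add: hom_dom\<close>)
  ultimately show ?thesis unfolding quot_comp quot_functor_arr[OF s] by blast
qed

end

locale torsion_adjunction = torsion_cat +
  fixes G :: "('a, ('b \<times> 'b) set, 'a, 'b) functr"
    and \<eta> :: "'a \<Rightarrow> 'b" and \<epsilon> :: "'a \<Rightarrow> ('b \<times> 'b) set"
  assumes adj: "adjunction C K quot G \<eta> \<epsilon>"
begin

section \<open>Objects and arrows under the adjunction\<close>

lemma unit_hom: "X \<in> Obj C \<Longrightarrow> \<eta> X \<in> Hom C X (FObj G X)"
  and unit_natural: "f \<in> Hom C X Y \<Longrightarrow> FArr G (FArr quot f) \<cdot> \<eta> X = \<eta> Y \<cdot> f"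
proof -
  have n: "nat_trans C C id_functor (comp_functor G quot) \<eta>" using adj by (simp add: adjunction_def)
  show "X \<in> Obj C \<Longrightarrow> \<eta> X \<in> Hom C X (FObj G X)"
    using n by (simp add: nat_trans_def comp_functor_def id_functor_def)
  assume f: "f \<in> Hom C X Y"
  have "\<eta> (Cod C f) \<cdot> f = FArr G (FArr quot f) \<cdot> \<eta> (Dom C f)"
    using n hom_arr[OF f] unfolding nat_trans_def comp_functor_def id_functor_def by simp
  then show "FArr G (FArr quot f) \<cdot> \<eta> X = \<eta> Y \<cdot> f" unfolding hom_dom[OF f] hom_cod[OF f] ..
qed

lemma counit_hom: "Y \<in> Obj C \<Longrightarrow> \<epsilon> Y \<in> Hom K (FObj G Y) Y"
proof -
  have "nat_trans K K (comp_functor quot G) id_functor \<epsilon>" using adj by (simp add: adjunction_def)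
  then show "Y \<in> Obj C \<Longrightarrow> \<epsilon> Y \<in> Hom K (FObj G Y) Y"
    by (simp add: nat_trans_def comp_functor_def id_functor_def)
qed

lemma triangle_quot: "X \<in> Obj C \<Longrightarrow> \<epsilon> X \<cdot>\<^bsub>K\<^esub> FArr quot (\<eta> X) = Ident K X"
  and triangle_G: "Y \<in> Obj C \<Longrightarrow> FArr G (\<epsilon> Y) \<cdot> \<eta> (FObj G Y) = Ident C (FObj G Y)"
  using adj by (simp_all add: adjunction_def)

lemma G_hom: "\<phi> \<in> Hom K X Y \<Longrightarrow> FArr G \<phi> \<in> Hom C (FObj G X) (FObj G Y)"
  and G_ident: "X \<in> Obj C \<Longrightarrow> FArr G (Ident K X) = Ident C (FObj G X)"
proof -
  have G: "is_functor K C G" using adj by (simp add: adjunction_def)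
  show "X \<in> Obj C \<Longrightarrow> FArr G (Ident K X) = Ident C (FObj G X)" using G by (simp add: is_functor_def)
  assume "\<phi> \<in> Hom K X Y"
  then have p: "\<phi> \<in> Arr K" "Dom K \<phi> = X" "Cod K \<phi> = Y" unfolding Hom_def by blast+
  have "FArr G \<phi> \<in> Hom C (FObj G (Dom K \<phi>)) (FObj G (Cod K \<phi>))"
    using G p(1) unfolding is_functor_def by blast
  then show "FArr G \<phi> \<in> Hom C (FObj G X) (FObj G Y)" unfolding p .
qed

lemma G_comp:
  assumes "\<phi> \<in> Hom K X Y" "\<psi> \<in> Hom K Y V"
  shows "FArr G (\<psi> \<cdot>\<^bsub>K\<^esub> \<phi>) = FArr G \<psi> \<cdot> FArr G \<phi>"
proof -
  have "is_functor K C G" using adj by (simp add: adjunction_def)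
  moreover have "\<phi> \<in> Arr K" "\<psi> \<in> Arr K" "Cod K \<phi> = Dom K \<psi>" using assms by (simp_all add: Hom_def)
  ultimately show ?thesis unfolding is_functor_def by blast
qed

lemma G_obj: "Y \<in> Obj C \<Longrightarrow> FObj G Y \<in> Obj C"
  using hom_obj(2)[OF unit_hom] .

text \<open>One round trip of the hom-set bijection, by naturality of the unit and a triangle
  identity. It shows that an arrow into \<open>FObj G Y\<close> is determined by its image under
  \<open>quot\<close>.\<close>

lemma transpose_transpose:
  assumes Y: "Y \<in> Obj C" and a: "a \<in> Hom C X (FObj G Y)"
  shows "FArr G (\<epsilon> Y \<cdot>\<^bsub>K\<^esub> FArr quot a) \<cdot> \<eta> X = a"
proof -
  have X: "X \<in> Obj C" using a hom_obj by blast
  note e = G_hom[OF counit_hom[OF Y]] and qa = G_hom[OF quot_functor_hom[OF a]]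
  have "FArr G (\<epsilon> Y \<cdot>\<^bsub>K\<^esub> FArr quot a) \<cdot> \<eta> X = FArr G (\<epsilon> Y) \<cdot> (\<eta> (FObj G Y) \<cdot> a)"
    unfolding G_comp[OF quot_functor_hom[OF a] counit_hom[OF Y]] hom_assoc[OF e qa unit_hom[OF X]]
      unit_natural[OF a] ..
  also have "\<dots> = (FArr G (\<epsilon> Y) \<cdot> \<eta> (FObj G Y)) \<cdot> a"
    using hom_assoc[OF e unit_hom[OF G_obj[OF Y]] a] by simp
  also have "\<dots> = a" unfolding triangle_G[OF Y] by (rule hom_ident(2)[OF a])
  finally show ?thesis .
qed

text \<open>The zero endomorphism of a torsion \<open>X\<close> is inverted. Any \<open>a\<close>
  agrees with zero after it, so both have the same image in the quotient and the same
  transpose.\<close>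

lemma G_torsion_free:
  assumes Y: "Y \<in> Obj C"
  shows "FObj G Y \<in> F"
proof (rule torsion_freeI[OF G_obj[OF Y]])
  fix X a assume X: "X \<in> T" and a: "a \<in> Hom C X (FObj G Y)"
  have XO: "X \<in> Obj C" using torsion_obj[OF X] .
  have zX: "z X X \<in> Hom C X X" and zY: "z X (FObj G Y) \<in> Hom C X (FObj G Y)"
    using XO G_obj[OF Y] by simp_all
  have d: "dense (z X X)" using dense_zero_arr_iff XO X by blast
  have "\<exists>V. \<exists>e\<in>Hom C V W. dense e \<and> b \<cdot> e = z V X" if b: "b \<in> Hom C W X" for W b
  proof -
    obtain P k y where k: "k \<in> Hom C P W" "y \<in> Hom C P X" "dense k" "b \<cdot> k = z X X \<cdot> y"
      using dense_square[OF zX d b] .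
    then have "b \<cdot> k = z P X" using XO by (simp add: Hom_iff)
    then show ?thesis using k by blast
  qed
  then have "quot_iso C T (z X X)" using quot_iso_iff[OF zX] d by blast
  moreover have "a \<cdot> z X X = z X (FObj G Y) \<cdot> z X X" using a XO by (simp add: Hom_iff)
  ultimately have "FArr quot a = FArr quot (z X (FObj G Y))" using quot_functor_eqI[OF a zY zX] by blast
  then have "FArr G (\<epsilon> Y \<cdot>\<^bsub>K\<^esub> FArr quot a) \<cdot> \<eta> X
      = FArr G (\<epsilon> Y \<cdot>\<^bsub>K\<^esub> FArr quot (z X (FObj G Y))) \<cdot> \<eta> X" by (simp only:)
  then show "a = z X (FObj G Y)" unfolding transpose_transpose[OF Y a] transpose_transpose[OF Y zY] .
qed

text \<open>\<open>\<psi>\<close> is a left inverse of the image of \<open>s\<close>. The extension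
  is the transpose of the image of \<open>a\<close> composed with \<open>\<psi>\<close>; naturality
  of the unit at \<open>s\<close> makes it restrict to \<open>a\<close>.\<close>

lemma G_extend:
  assumes Y: "Y \<in> Obj C" and s: "s \<in> Hom C X V" "quot_iso C T s" and a: "a \<in> Hom C X (FObj G Y)"
  obtains b where "b \<in> Hom C V (FObj G Y)" "b \<cdot> s = a"
proof -
  have X: "X \<in> Obj C" and V: "V \<in> Obj C" using s hom_obj by auto
  define \<psi> where "\<psi> = roof_class C T (s, Ident C X)"
  have p: "\<psi> \<in> Hom K V X" unfolding \<psi>_def using roof_class_hom[OF s(1) ident_hom[OF X] s(2)] .
  have "\<psi> \<cdot>\<^bsub>K\<^esub> FArr quot s = FArr quot (Ident C X)"
    unfolding \<psi>_def by (rule roof_class_comp_denominator[OF s(1) ident_hom[OF X] s(2)])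
  also have "\<dots> = Ident K X" using X by (simp add: quot_functor_def quot_cat_def)
  finally have ps: "\<psi> \<cdot>\<^bsub>K\<^esub> FArr quot s = Ident K X" .
  note Ge = G_hom[OF counit_hom[OF Y]] and Ga = G_hom[OF quot_functor_hom[OF a]] and Gp = G_hom[OF p]
    and Gs = G_hom[OF quot_functor_hom[OF s(1)]]
  let ?e = "FArr G (\<epsilon> Y) \<cdot> FArr G (FArr quot a)"
  have e: "?e \<in> Hom C (FObj G X) (FObj G Y)" using Ge Ga by blast
  have "FArr G \<psi> \<cdot> (\<eta> V \<cdot> s) = FArr G \<psi> \<cdot> (FArr G (FArr quot s) \<cdot> \<eta> X)" unfolding unit_natural[OF s(1)] ..
  also have "\<dots> = (FArr G \<psi> \<cdot> FArr G (FArr quot s)) \<cdot> \<eta> X" using hom_assoc[OF Gp Gs unit_hom[OF X]] by simp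
  also have "\<dots> = \<eta> X"
    unfolding G_comp[OF quot_functor_hom[OF s(1)] p, symmetric] ps G_ident[OF X] by (rule hom_ident(2)[OF unit_hom[OF X]])
  finally have *: "FArr G \<psi> \<cdot> (\<eta> V \<cdot> s) = \<eta> X" .
  have "(?e \<cdot> (FArr G \<psi> \<cdot> \<eta> V)) \<cdot> s = ?e \<cdot> (FArr G \<psi> \<cdot> (\<eta> V \<cdot> s))"
    unfolding hom_assoc[OF e hom_comp[OF Gp unit_hom[OF V]] s(1)] hom_assoc[OF Gp unit_hom[OF V] s(1)] ..
  also have "\<dots> = a"
    unfolding * using transpose_transpose[OF Y a] G_comp[OF quot_functor_hom[OF a] counit_hom[OF Y]] by simp
  finally show ?thesis using that[of "?e \<cdot> (FArr G \<psi> \<cdot> \<eta> V)"] e Gp unit_hom[OF V] by blast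
qed

text \<open>In an extension by a torsion object the inclusion \<open>i\<close> is a dense
  monomorphism, hence inverted. Extending the identity along it yields the retraction.\<close>

lemma G_faithfully_injective:
  assumes Y: "Y \<in> Obj C"
  shows "faithfully_injective C \<gamma> \<iota> (FObj G Y)"
proof -
  have "extensions C X (FObj G Y) \<subseteq> Ext1_zero C X (FObj G Y)" if X: "X \<in> T" for X
  proof
    fix x assume x: "x \<in> extensions C X (FObj G Y)"
    obtain i p where ip: "x = (i, p)" by force
    obtain E where i: "i \<in> Hom C (FObj G Y) E" and p: "p \<in> Hom C E X" and ex: "short_exact C i p"
      using x unfolding ip extensions_iff by blast
    have k: "is_kernel C i p" "is_cokernel C p i" using ex by (simp_all add: short_exact_def)
    have "quot_iso C T i"
      using dense_mono_quot_iso[OF kernel_facts(1)[OF k(1) i p] i] dense_iff_cokernel_torsion[OF i k(2) p] X by blast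
    then obtain r where "r \<in> Hom C E (FObj G Y)" "r \<cdot> i = Ident C (FObj G Y)"
      using G_extend[OF Y i _ ident_hom[OF G_obj[OF Y]]] by blast
    then show "x \<in> Ext1_zero C X (FObj G Y)" using x hom_cod[OF i] unfolding ip Ext1_zero_def by blast
  qed
  then show ?thesis
    unfolding faithfully_injective_def rel_injective_def
    using G_torsion_free[OF Y] G_obj[OF Y] Ext1_trivial_iff torsion_obj by blast
qed

text \<open>Composing the counit with the image of \<open>s\<close> cancels the denominator and
  leaves the image of \<open>g\<close>. Thus \<open>s\<close> is the transpose of the latter, which
  naturality of the unit rewrites as \<open>\<eta> M \<cdot> g\<close>.\<close>

lemma counit_roof:
  assumes M: "M \<in> Obj C"
  obtains X s g where "s \<in> Hom C X (FObj G M)" "g \<in> Hom C X M" "quot_iso C T s"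
    "\<epsilon> M = roof_class C T (s, g)" "\<eta> M \<cdot> g = s"
proof -
  obtain X s g where s: "s \<in> Hom C X (FObj G M)" "g \<in> Hom C X M" "quot_iso C T s"
    "\<epsilon> M = roof_class C T (s, g)"
    using quot_hom_roof[OF counit_hom[OF M]] .
  have "\<epsilon> M \<cdot>\<^bsub>K\<^esub> FArr quot s = FArr quot g"
    unfolding s(4) by (rule roof_class_comp_denominator[OF s(1-3)])
  then have "s = FArr G (FArr quot g) \<cdot> \<eta> X" using transpose_transpose[OF M s(1)] by simp
  then have "\<eta> M \<cdot> g = s" using unit_natural[OF s(2)] by simp
  then show ?thesis using that s by blast
qed

text \<open>The triangle identity gives, on the domain of an inverted \<open>u\<close>, a lift
  \<open>v'\<close> of the unit through \<open>s\<close> from which \<open>g\<close> recovers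
  \<open>u\<close>. An arrow killed by the unit therefore vanishes after a dense arrow, and so
  vanishes, as \<open>M\<close> is torsion-free.\<close>

lemma unit_mono:
  assumes M: "M \<in> F"
  shows "mono_arr C (\<eta> M)"
proof -
  have MO: "M \<in> Obj C" using torsion_free_obj[OF M] .
  note h = unit_hom[OF MO] and hM = ident_hom[OF MO]
  obtain X s g where s: "s \<in> Hom C X (FObj G M)" "g \<in> Hom C X M" "quot_iso C T s"
    "\<epsilon> M = roof_class C T (s, g)"
    using counit_roof[OF MO] by metis
  obtain B w v where w: "w \<in> Hom C B M" "v \<in> Hom C B X" "quot_iso C T w" "\<eta> M \<cdot> w = s \<cdot> v"
    using quot_iso_ore[OF s(3,1) h] .
  \<comment> \<open>\<open>Comp\<close> is a union, so the class built from this one Ore square lies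
    in the composite, which the triangle identity equates with the identity class.\<close>
  have "roof_class C T (Ident C M \<cdot> w, g \<cdot> v) \<subseteq> \<epsilon> M \<cdot>\<^bsub>K\<^esub> FArr quot (\<eta> M)"
    unfolding quot_comp
  proof (rule Union_upper, rule CollectI, intro exI conjI)
    show "(Ident C M, \<eta> M) \<in> FArr quot (\<eta> M)"
      unfolding quot_functor_arr[OF h] roof_class_mem by (rule roof_equiv_refl[OF hM h quot_iso_ident[OF MO]])
    show "(s, g) \<in> \<epsilon> M" unfolding s(4) roof_class_mem by (rule roof_equiv_refl[OF s(1-3)])
  qed (use w s h in \<open>auto simp: Hom_def\<close>)
  moreover have "(w, g \<cdot> v) \<in> roof_class C T (Ident C M \<cdot> w, g \<cdot> v)"
    unfolding roof_class_mem hom_ident(2)[OF w(1)] using roof_equiv_refl[OF w(1) hom_comp[OF s(2) w(2)] w(3)] .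
  ultimately have "(w, g \<cdot> v) \<in> Ident K M" unfolding triangle_quot[OF MO] by blast
  then have "roof_equiv C T (Ident C M, Ident C M) (w, g \<cdot> v)"
    unfolding roof_class_mem[symmetric] by (simp add: quot_cat_def)
  from roof_equivE[OF this hM hM] obtain X' W u u' where
    u0: "w \<in> Hom C X' M" "u \<in> Hom C W M" "u' \<in> Hom C W X'" "Ident C M \<cdot> u = w \<cdot> u'" "quot_iso C T (Ident C M \<cdot> u)"
      "Ident C M \<cdot> u = (g \<cdot> v) \<cdot> u'" by metis
  have X': "X' = B" using u0(1) w(1) by (simp add: Hom_def)
  have u: "quot_iso C T u" "u = w \<cdot> u'" "u = (g \<cdot> v) \<cdot> u'"
    using u0(4-6) unfolding hom_ident(2)[OF u0(2)] by simp_all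
  have u': "u' \<in> Hom C W B" using u0(3) X' by simp
  define v' where "v' = v \<cdot> u'"
  have v': "v' \<in> Hom C W X" using w u' by (auto simp: v'_def)
  have gv: "g \<cdot> v' = u" unfolding u(3) using s(2) w(2) u' by (simp add: v'_def Hom_iff)
  have hu: "\<eta> M \<cdot> u = s \<cdot> v'"
    unfolding u(2) using h w(1,2) s(1) u' by (simp add: v'_def Hom_iff reassoc[OF w(4)])
  have "a = z V M" if a: "a \<in> Hom C V M" "\<eta> M \<cdot> a = z V (FObj G M)" for V a
  proof -
    \<comment> \<open>After the dense \<open>e\<close>, \<open>a\<close> passes through
      \<open>u\<close>. Then \<open>s\<close> kills \<open>v' \<cdot> a'\<close>, which vanishes
      after a dense \<open>e'\<close>; applying \<open>g\<close> turns \<open>v'\<close> back into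
      \<open>u\<close>.\<close>
    obtain P e a' where e: "e \<in> Hom C P V" "a' \<in> Hom C P W" "dense e" "a \<cdot> e = u \<cdot> a'"
      using dense_square[OF u0(2) quot_iso_dense[OF u(1) u0(2)] a(1)] .
    have "s \<cdot> (v' \<cdot> a') = \<eta> M \<cdot> (a \<cdot> e)"
      unfolding e(4) using s(1) v' h u0(2) e(2) by (simp add: Hom_iff reassoc[OF hu])
    also have "\<dots> = z P (FObj G M)"
      using h a(1) e(1) G_obj[OF MO] by (simp add: Hom_iff reassoc[OF a(2)])
    finally obtain R e' where e': "e' \<in> Hom C R P" "dense e'" "(v' \<cdot> a') \<cdot> e' = z R X"
      using quot_iso_zero[OF s(3,1) hom_comp[OF v' e(2)]] by metis
    have "a \<cdot> (e \<cdot> e') = (u \<cdot> a') \<cdot> e'"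
      unfolding e(4)[symmetric] using a(1) e(1) e'(1) by (simp add: Hom_iff)
    also have "\<dots> = g \<cdot> ((v' \<cdot> a') \<cdot> e')"
      unfolding gv[symmetric] using s(2) v' e(2) e'(1) by (simp add: Hom_iff)
    also have "\<dots> = z R M" unfolding e'(3) using s(2) e'(1) by (simp add: Hom_iff)
    finally show ?thesis
      using dense_zero[OF dense_comp[OF e(3,1) e'(2,1)] hom_comp[OF e(1) e'(1)] M a(1)] by blast
  qed
  then show ?thesis using mono_iff[OF h] by blast
qed

lemma unit_universal:
  assumes M: "M \<in> F" and D: "faithfully_injective C \<gamma> \<iota> D" and f: "f \<in> Hom C M D" "mono_arr C f"
  obtains \<theta> where "\<theta> \<in> Hom C (FObj G M) D" "mono_arr C \<theta>" "\<theta> \<cdot> \<eta> M = f"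
proof -
  have MO: "M \<in> Obj C" using torsion_free_obj[OF M] .
  note h = unit_hom[OF MO] and hm = unit_mono[OF M]
  obtain X s g where s: "s \<in> Hom C X (FObj G M)" "g \<in> Hom C X M" "quot_iso C T s" "\<eta> M \<cdot> g = s"
    using counit_roof[OF MO] by metis
  note ds = quot_iso_dense[OF s(3,1)]
  have "dense (\<eta> M)" using dense_of_comp[OF _ h s(2)] ds s(4) by simp
  moreover obtain Q q where q: "q \<in> Hom C (FObj G M) Q" "is_cokernel C q (\<eta> M)" using ex_cokernel[OF h] .
  ultimately have Q: "Q \<in> T" using dense_iff_cokernel_torsion[OF h q(2,1)] by blast
  obtain E i p c where i: "i \<in> Hom C D E" and p: "p \<in> Hom C E Q" and ex: "short_exact C i p"
    and c: "c \<in> Hom C (FObj G M) E" and cm: "c \<cdot> \<eta> M = i \<cdot> f"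
    using pushout_extension[OF h hm q f(1)] .
  have "Ext1 C Q D = {Ext1_zero C Q D}"
    using D Q by (simp add: faithfully_injective_def rel_injective_def)
  then have "extensions C Q D \<subseteq> Ext1_zero C Q D"
    using Ext1_trivial_iff[OF torsion_obj[OF Q] hom_obj(2)[OF f(1)]] by blast
  then have "(i, p) \<in> Ext1_zero C Q D" using extensions_iff i p ex by blast
  then obtain r where r: "r \<in> Hom C E D" "r \<cdot> i = Ident C D"
    using hom_cod[OF i] unfolding Ext1_zero_def by auto
  define \<theta> where "\<theta> = r \<cdot> c"
  have t: "\<theta> \<in> Hom C (FObj G M) D" using r c by (auto simp: \<theta>_def)
  have th: "\<theta> \<cdot> \<eta> M = f"
    using r(1) c h i f(1) by (simp add: \<theta>_def Hom_iff cm reassoc[OF r(2)])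
  have "a = z W (FObj G M)" if a: "a \<in> Hom C W (FObj G M)" "\<theta> \<cdot> a = z W D" for W a
  proof -
    \<comment> \<open>After a dense arrow, \<open>a\<close> lands in the image of \<open>s\<close>,
      hence of the unit. On that image \<open>\<theta>\<close> acts as the monomorphism
      \<open>f\<close>, so the preimage \<open>g \<cdot> y\<close> vanishes.\<close>
    obtain P e y where e: "e \<in> Hom C P W" "y \<in> Hom C P X" "dense e" "a \<cdot> e = s \<cdot> y"
      using dense_square[OF s(1) ds a(1)] .
    have sy: "s \<cdot> y = \<eta> M \<cdot> (g \<cdot> y)" unfolding s(4)[symmetric] using h s(2) e(2) by (simp add: Hom_iff)
    have "f \<cdot> (g \<cdot> y) = \<theta> \<cdot> (a \<cdot> e)"
      unfolding e(4) sy using t h s(2) e(2) f(1) by (simp add: Hom_iff reassoc[OF th])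
    also have "\<dots> = z P D" using t a(1) e(1) hom_obj(2)[OF t] by (simp add: Hom_iff reassoc[OF a(2)])
    finally have "g \<cdot> y = z P M" using mono_zero[OF f(2,1) hom_comp[OF s(2) e(2)]] by blast
    then have "a \<cdot> e = z P (FObj G M)" unfolding e(4) sy using h e(2) by (simp add: Hom_iff)
    then show ?thesis using dense_zero[OF e(3,1) G_torsion_free[OF MO] a(1)] by blast
  qed
  then have "mono_arr C \<theta>" using mono_iff[OF t] by blast
  then show ?thesis using that t th by blast
qed

end

theorem theorem3p8:
  fixes A :: "('o, 'm) cat"
    and \<gamma> :: "('o, 'm, 'o, 'm) functr"
    and \<iota> :: "'o \<Rightarrow> 'm"
    and F :: "('o, 'm, 'o, ('m \<times> 'm) set) functr"
    and G :: "('o, ('m \<times> 'm) set, 'o, 'm) functr"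
    and h :: "'o \<Rightarrow> 'm"
    and \<epsilon> :: "'o \<Rightarrow> ('m \<times> 'm) set"
    and M :: 'o
  assumes "small_universe TYPE('u)"
    and "locally_noetherian_grothendieck TYPE('u) A"
    and "left_exact_radical A \<gamma> \<iota>"
    and "F = quot_functor A (torsion A \<iota>)"
    and "adjunction A (quot_cat A (torsion A \<iota>)) F G h \<epsilon>"
    and "M \<in> torsion_free A \<gamma>"
  shows "faithfully_injective A \<gamma> \<iota> (FObj G (FObj F M))
    \<and> h M \<in> Hom A M (FObj G (FObj F M)) \<and> mono_arr A (h M)
    \<and> (\<forall>D\<^sub>1 f. faithfully_injective A \<gamma> \<iota> D\<^sub>1 \<longrightarrow> f \<in> Hom A M D\<^sub>1 \<longrightarrow> mono_arr A f \<longrightarrow>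
         (\<exists>\<theta>\<in>Hom A (FObj G (FObj F M)) D\<^sub>1. mono_arr A \<theta> \<and> \<theta> \<cdot>\<^bsub>A\<^esub> h M = f))"
proof -
  have "abelian A" using assms(2) by (simp add: locally_noetherian_grothendieck_def grothendieck_def)
  moreover then obtain add z where "preadditive A add z" by (auto simp: abelian_def)
  ultimately interpret torsion_adjunction A add z \<gamma> \<iota> G h \<epsilon>
    using assms(3,5) unfolding assms(4) by unfold_locales
  \<comment> \<open>The quotient has the objects of \<open>A\<close>, so
    \<open>FObj G (FObj F M)\<close> takes the form \<open>FObj G M\<close> used in the
    locale.\<close>
  have FM: "FObj F M = M" by (simp add: assms(4))
  have "M \<in> Obj A" using torsion_free_obj assms(6) by blast
  then show ?thesis
    unfolding FM using G_faithfully_injective unit_hom unit_mono[OF assms(6)] unit_universal[OF assms(6)]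
    by metis
qed

end
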